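(* Let $M$ be a noetherian gcd-monoid satisfying the $3$-Ore condition. Then every element of $U(M)$ is represented by a unique $\widehat{\mathcal R}_M$-irreducible multifraction. The monoid $M$ embeds in the group $U(M)$. Moreover, for all multifractions $\underline a,\underline b$ on $M$, denoting by $\widehat{\mathrm{red}}(\underline a)$ the unique $\widehat{\mathcal R}_M$-irreducible reduct of $\underline a$: $$\iota(\underline a)=\iota(\underline b)\iff\widehat{\mathrm{red}}(\underline a)=\widehat{\mathrm{red}}(\underline b),$$ $$\underline a\text{ represents }1\text{ in }U(M)\iff\underline a\mathrel{\widehat{\Rightarrow}{}^*}\varnothing,$$ $$\iota(\underline a)\cdot\iota(\underline b)=\iota(\widehat{\mathrm{red}}(\underline a\cdot\underline b)).$$
   Context: For $a,b$ in a monoid $M$: $a$ left divides $b$ if $b=ax$ for some $x$ ($b$ is a right multiple of $a$); $a$ right divides $b$ if $b=xa$ for some $x$ ($b$ is a left multiple of $a$). A gcd-monoid is a cancellative monoid with no nontrivial invertible element in which any two elements admit a left gcd and a right gcd. In a gcd-monoid, two elements with a common right (resp. left) multiple have a unique right lcm $a\vee b$ (resp. left lcm $a\mathbin{\tilde\vee}b$). $M$ is noetherian if the proper left and proper right divisibility relations are both well-founded. $3$-Ore condition: any three elements of $M$ that pairwise admit a common right (resp. left) multiple admit a global common right (resp. left) multiple (both versions are required). $U(M)$ is the enveloping (universal) group of $M$, $\iota:M\to U(M)$ the canonical morphism. A multifraction on $M$ is a finite sequence $\underline a=a_1/\cdots/a_n$ of elements of $M$; $n$ is its depth $\|\underline a\|$;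 $\varnothing$ is the empty sequence. The multifraction $\underline a$ represents $\iota(\underline a):=\iota(a_1)\iota(a_2)^{-1}\iota(a_3)\iota(a_4)^{-1}\cdots\in U(M)$, with $\iota(\varnothing)=1$. The product of nonempty multifractions of depths $n,p$ is $\underline a\cdot\underline b=a_1/\cdots/a_n/b_1/\cdots/b_p$ for $n$ even and $a_1/\cdots/a_{n-1}/a_nb_1/b_2/\cdots/b_p$ for $n$ odd, and $\varnothing$ is neutral. For $i\ge1$ and $x\in M$, one writes $\underline b=\underline a\bullet R_{i,x}$ if $\|\underline b\|=\|\underline a\|>i$, $b_k=a_k$ for $k\ne i-1,i,i+1$, and there is $x'\in M$ with: - $i$ even: $b_{i-1}=a_{i-1}x'$, $xb_i=a_ix'=x\vee a_i$, $xb_{i+1}=a_{i+1}$; - $i\ge3$ odd: $b_{i-1}=x'a_{i-1}$, $b_ix=x'a_i=x\mathbin{\tilde\vee}a_i$, $b_{i+1}x=a_{i+1}$; - $i=1$: $b_1x=a_1$, $b_2x=a_2$. The rewrite system $\widehat{\mathcal R}_M$ consists of all rules $R_{i,x}$ with $x\ne1$ together with the rule $R_\times$ removing the last entry of a multifraction when it is $1$; one step is written $\widehat\Rightarrow$ and $\widehat{\Rightarrow}{}^*$ is its reflexive-transitive closure. A multifraction is $\widehat{\mathcal R}_M$-irreducible if no rule applies to it; a reduct of $\underline a$ is any $\underline b$ with $\underline a\mathrel{\widehat{\Rightarrow}{}^*}\underline b$. (Under the present assumptions, each multifraction has exactly one irreducible reduct.) *)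

theory Defs
  imports "HOL-Algebra.Divisibility"
begin

section \<open>Divisibility in noncommutative monoids\<close>

text \<open>
  In a noncommutative monoid, \<^const>\<open>factor\<close> is left divisibility: \<open>a divides b\<close> means
  \<open>b = a \<otimes> c\<close> for some \<open>c\<close>. Hence \<^const>\<open>isgcd\<close> is the left gcd and \<^const>\<open>islcm\<close>, the least
  common multiple for left divisibility, is the right lcm. The mirror notions (right
  divisibility, right gcd, common left multiple, left lcm) are the same notions in the
  opposite monoid.
\<close>

definition opposite :: "('a, 'b) monoid_scheme \<Rightarrow> 'a monoid" where
  "opposite M = \<lparr>carrier = carrier M, monoid.mult = (\<lambda>x y. y \<otimes>\<^bsub>M\<^esub> x), one = \<one>\<^bsub>M\<^esub>\<rparr>"

lemma carrier_opposite [simp]: "carrier (opposite M) = carrier M"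
  and mult_opposite [simp]: "x \<otimes>\<^bsub>opposite M\<^esub> y = y \<otimes>\<^bsub>M\<^esub> x"
  and one_opposite [simp]: "\<one>\<^bsub>opposite M\<^esub> = \<one>\<^bsub>M\<^esub>"
  by (simp_all add: opposite_def)

lemma divides_opposite_iff: "a divides\<^bsub>opposite M\<^esub> b \<longleftrightarrow> (\<exists>x\<in>carrier M. b = x \<otimes>\<^bsub>M\<^esub> a)"
  by (simp add: factor_def)

locale gcd_monoid = monoid_cancel M for M (structure) +
  assumes Units_trivial: "Units M = {\<one>}"
    and left_gcd_exists:
      "\<lbrakk>a \<in> carrier M; b \<in> carrier M\<rbrakk> \<Longrightarrow> \<exists>d\<in>carrier M. d gcdof\<^bsub>M\<^esub> a b"
    and right_gcd_exists:
      "\<lbrakk>a \<in> carrier M; b \<in> carrier M\<rbrakk> \<Longrightarrow> \<exists>d\<in>carrier M. d gcdof\<^bsub>opposite M\<^esub> a b"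

text \<open>
  In a cancellative monoid without nontrivial unit, \<open>properfactor M a b\<close> amounts to
  \<open>b = a \<otimes> c\<close> with \<open>c \<noteq> \<one>\<close>.
\<close>

definition noetherian :: "('a, 'b) monoid_scheme \<Rightarrow> bool" where
  "noetherian M \<longleftrightarrow>
     wfp_on (carrier M) (properfactor M) \<and> wfp_on (carrier M) (properfactor (opposite M))"

definition have_common_right_multiple :: "('a, 'b) monoid_scheme \<Rightarrow> 'a set \<Rightarrow> bool" where
  "have_common_right_multiple M A \<longleftrightarrow> (\<exists>m\<in>carrier M. \<forall>a\<in>A. a divides\<^bsub>M\<^esub> m)"

definition right_three_ore :: "('a, 'b) monoid_scheme \<Rightarrow> bool" where
  "right_three_ore M \<longleftrightarrow>
     (\<forall>a\<in>carrier M. \<forall>b\<in>carrier M. \<forall>c\<in>carrier M.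
        have_common_right_multiple M {a, b} \<and> have_common_right_multiple M {b, c} \<and>
        have_common_right_multiple M {a, c} \<longrightarrow> have_common_right_multiple M {a, b, c})"

definition three_ore :: "('a, 'b) monoid_scheme \<Rightarrow> bool" where
  "three_ore M \<longleftrightarrow> right_three_ore M \<and> right_three_ore (opposite M)"


section \<open>The enveloping group\<close>

text \<open>
  A letter \<open>(True, a)\<close> stands for the generator \<open>a\<close>, and \<open>(False, a)\<close> for its formal inverse.
  The enveloping group is the group presented by the elements of \<open>M\<close> subject to all the relations
  \<open>a \<cdot> b = ab\<close> that hold in \<open>M\<close>.
\<close>

definition signed_words :: "('a, 'b) monoid_scheme \<Rightarrow> (bool \<times> 'a) list set" where
  "signed_words M = lists (UNIV \<times> carrier M)"

inductive env_eq :: "('a, 'b) monoid_scheme \<Rightarrow> (bool \<times> 'a) list \<Rightarrow> (bool \<times> 'a) list \<Rightarrow> bool"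
  for M (structure) where
  env_refl: "u \<in> signed_words M \<Longrightarrow> env_eq M u u"
| env_sym: "env_eq M u v \<Longrightarrow> env_eq M v u"
| env_trans: "env_eq M u v \<Longrightarrow> env_eq M v w \<Longrightarrow> env_eq M u w"
| env_append: "env_eq M u u' \<Longrightarrow> env_eq M v v' \<Longrightarrow> env_eq M (u @ v) (u' @ v')"
| env_one: "env_eq M [(True, \<one>)] []"
| env_mult: "a \<in> carrier M \<Longrightarrow> b \<in> carrier M \<Longrightarrow>
    env_eq M [(True, a), (True, b)] [(True, a \<otimes> b)]"
| env_r_inv: "a \<in> carrier M \<Longrightarrow> env_eq M [(True, a), (False, a)] []"
| env_l_inv: "a \<in> carrier M \<Longrightarrow> env_eq M [(False, a), (True, a)] []"

definition env_rel :: "('a, 'b) monoid_scheme \<Rightarrow> ((bool \<times> 'a) list \<times> (bool \<times> 'a) list) set" where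
  "env_rel M = {(u, v). env_eq M u v}"

definition env_group :: "('a, 'b) monoid_scheme \<Rightarrow> (bool \<times> 'a) list set monoid" where
  "env_group M =
     \<lparr>carrier = signed_words M // env_rel M,
      monoid.mult = (\<lambda>X Y. \<Union>u\<in>X. \<Union>v\<in>Y. env_rel M `` {u @ v}),
      one = env_rel M `` {[]}\<rparr>"

definition env_emb :: "('a, 'b) monoid_scheme \<Rightarrow> 'a \<Rightarrow> (bool \<times> 'a) list set" where
  "env_emb M a = env_rel M `` {[(True, a)]}"

lemma signed_words_simps [simp]:
  "[] \<in> signed_words M"
  "p # u \<in> signed_words M \<longleftrightarrow> snd p \<in> carrier M \<and> u \<in> signed_words M"
  "u @ v \<in> signed_words M \<longleftrightarrow> u \<in> signed_words M \<and> v \<in> signed_words M"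
  by (cases p; auto simp: signed_words_def)+

context monoid
begin

lemma env_eq_words:
  assumes "env_eq G u v"
  shows "u \<in> signed_words G" and "v \<in> signed_words G"
  using assms by (induction rule: env_eq.induct) simp_all

lemma equiv_env_rel: "equiv (signed_words G) (env_rel G)"
  by (rule equivI)
     (auto simp: env_rel_def refl_on_def sym_def trans_def
           intro: env_refl env_sym env_trans dest: env_eq_words)

lemma env_class_eq_iff:
  "u \<in> signed_words G \<Longrightarrow> v \<in> signed_words G \<Longrightarrow>
     env_rel G `` {u} = env_rel G `` {v} \<longleftrightarrow> env_eq G u v"
  using equiv_env_rel eq_equiv_class_iff[of "signed_words G" "env_rel G" u v]
  by (simp add: env_rel_def)

lemma env_mult_class:
  assumes "u \<in> signed_words G" "v \<in> signed_words G"
  shows "env_rel G `` {u} \<otimes>\<^bsub>env_group G\<^esub> env_rel G `` {v} = env_rel G `` {u @ v}"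
proof -
  have "env_rel G `` {u' @ v'} = env_rel G `` {u @ v}"
    if "env_eq G u u'" "env_eq G v v'" for u' v'
  proof -
    have "env_eq G (u' @ v') (u @ v)" by (rule env_sym) (rule env_append[OF that])
    then show ?thesis using env_class_eq_iff env_eq_words by blast
  qed
  then have "(\<Union>u'\<in>env_rel G `` {u}. \<Union>v'\<in>env_rel G `` {v}. env_rel G `` {u' @ v'})
      = (\<Union>u'\<in>env_rel G `` {u}. \<Union>v'\<in>env_rel G `` {v}. env_rel G `` {u @ v})"
    by (intro SUP_cong refl) (simp add: env_rel_def)
  moreover have "u \<in> env_rel G `` {u}" "v \<in> env_rel G `` {v}"
    using assms by (auto simp: env_rel_def intro: env_refl)
  then have "env_rel G `` {u} \<noteq> {}" "env_rel G `` {v} \<noteq> {}" by blast+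
  ultimately show ?thesis
    by (simp add: env_group_def)
qed

lemma env_carrierE:
  assumes "X \<in> carrier (env_group G)"
  obtains u where "u \<in> signed_words G" "X = env_rel G `` {u}"
  using assms by (auto simp: env_group_def elim: quotientE)

lemma env_class_closed: "u \<in> signed_words G \<Longrightarrow> env_rel G `` {u} \<in> carrier (env_group G)"
  by (simp add: env_group_def quotientI)

lemma env_one_class: "\<one>\<^bsub>env_group G\<^esub> = env_rel G `` {[]}"
  by (simp add: env_group_def)

lemma env_word_inverse:
  "u \<in> signed_words G \<Longrightarrow> \<exists>v\<in>signed_words G. env_eq G (v @ u) []"
proof (induction u)
  case Nil
  then show ?case by (auto intro!: bexI[of _ "[]"] env_refl)
next
  case (Cons p u)
  then obtain v where v: "v \<in> signed_words G" "env_eq G (v @ u) []" by auto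
  obtain s a where p: "p = (s, a)" by (cases p)
  have a: "a \<in> carrier G" using Cons.prems p by simp
  have "env_eq G [(\<not> s, a), (s, a)] []"
    using a by (cases s) (auto intro: env_r_inv env_l_inv)
  moreover have "env_eq G v v" "env_eq G u u"
    using v Cons.prems by (auto intro: env_refl)
  ultimately have "env_eq G (v @ [(\<not> s, a), (s, a)] @ u) (v @ [] @ u)"
    by (intro env_append)
  then have "env_eq G ((v @ [(\<not> s, a)]) @ p # u) []"
    using v(2) p by (auto intro: env_trans)
  then show ?case using v(1) a by (intro bexI[of _ "v @ [(\<not> s, a)]"]) auto
qed

text \<open>
  The following facts confirm that \<^const>\<open>env_group\<close> with \<^const>\<open>env_emb\<close> has the universal
  property that characterises the enveloping group.
\<close>

theorem group_env_group: "group (env_group G)"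
proof (rule groupI)
  fix X assume "X \<in> carrier (env_group G)"
  then obtain u where u: "u \<in> signed_words G" "X = env_rel G `` {u}" by (rule env_carrierE)
  then obtain v where v: "v \<in> signed_words G" "env_eq G (v @ u) []"
    using env_word_inverse by blast
  then have "env_rel G `` {v} \<otimes>\<^bsub>env_group G\<^esub> X = \<one>\<^bsub>env_group G\<^esub>"
    using u by (simp add: env_mult_class env_one_class env_class_eq_iff)
  then show "\<exists>Y\<in>carrier (env_group G). Y \<otimes>\<^bsub>env_group G\<^esub> X = \<one>\<^bsub>env_group G\<^esub>"
    using v env_class_closed by blast
qed (auto elim!: env_carrierE simp: env_mult_class env_one_class intro!: env_class_closed)

theorem env_emb_hom: "env_emb G \<in> hom G (env_group G)"
  by (rule homI)
     (auto simp: env_emb_def env_mult_class env_class_eq_iff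
           intro!: env_class_closed env_sym[OF env_mult])

theorem env_group_universal:
  assumes H: "group H" and f: "f \<in> hom G H"
  shows "\<exists>h\<in>hom (env_group G) H. \<forall>a\<in>carrier G. h (env_emb G a) = f a"
proof -
  interpret H: group H by fact
  have fc [simp]: "f a \<in> carrier H" if "a \<in> carrier G" for a
    using f that by (auto simp: hom_def)
  have f1: "f \<one> = \<one>\<^bsub>H\<^esub>"
    using f by (metis H.r_cancel_one fc hom_mult l_one one_closed)
  define val where
    "val u = foldr (\<lambda>(s, a) y. (if s then f a else inv\<^bsub>H\<^esub> f a) \<otimes>\<^bsub>H\<^esub> y) u \<one>\<^bsub>H\<^esub>" for u
  have val_Nil [simp]: "val [] = \<one>\<^bsub>H\<^esub>"
    and val_Cons [simp]: "val ((s, a) # u) = (if s then f a else inv\<^bsub>H\<^esub> f a) \<otimes>\<^bsub>H\<^esub> val u"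
    for s a u by (simp_all add: val_def)
  have val_closed [simp]: "val u \<in> carrier H" if "u \<in> signed_words G" for u
    using that by (induction u) auto
  have val_append: "val (u @ v) = val u \<otimes>\<^bsub>H\<^esub> val v"
    if "u \<in> signed_words G" "v \<in> signed_words G" for u v
    using that by (induction u) (auto simp: H.m_assoc)
  have val_eq: "val u = val v" if "env_eq G u v" for u v
    using that
  proof (induction rule: env_eq.induct)
    case (env_append u u' v v')
    then show ?case by (metis env_eq_words val_append)
  next
    case (env_mult a b)
    then show ?case using f by (simp add: hom_mult)
  qed (simp_all add: f1)
  define h where "h X = val (SOME u. u \<in> X)" for X
  have h: "h (env_rel G `` {u}) = val u" if "u \<in> signed_words G" for u
  proof -
    have "u \<in> env_rel G `` {u}" using that by (auto simp: env_rel_def intro: env_refl)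
    then have "(SOME v. v \<in> env_rel G `` {u}) \<in> env_rel G `` {u}" by (rule someI)
    then show ?thesis unfolding h_def using val_eq by (auto simp: env_rel_def)
  qed
  have "h \<in> hom (env_group G) H"
    by (rule homI) (auto elim!: env_carrierE simp: h env_mult_class val_append)
  moreover have "\<forall>a\<in>carrier G. h (env_emb G a) = f a"
    by (simp add: env_emb_def h)
  ultimately show ?thesis by blast
qed

theorem env_group_universal_unique:
  assumes H: "group H" and h: "h \<in> hom (env_group G) H" and k: "k \<in> hom (env_group G) H"
    and eq: "\<And>a. a \<in> carrier G \<Longrightarrow> h (env_emb G a) = k (env_emb G a)"
    and X: "X \<in> carrier (env_group G)"
  shows "h X = k X"
proof -
  interpret U: group "env_group G" by (rule group_env_group)
  interpret H: group H by fact
  interpret h: group_hom "env_group G" H h by unfold_locales (rule h)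
  interpret k: group_hom "env_group G" H k by unfold_locales (rule k)
  have letter: "h (env_rel G `` {[(s, a)]}) = k (env_rel G `` {[(s, a)]})"
    if a: "a \<in> carrier G" for s a
  proof (cases s)
    case False
    have pos: "env_rel G `` {[(True, a)]} \<in> carrier (env_group G)"
      and neg: "env_rel G `` {[(False, a)]} \<in> carrier (env_group G)"
      using a by (auto intro!: env_class_closed)
    have "env_rel G `` {[(False, a)]} \<otimes>\<^bsub>env_group G\<^esub> env_rel G `` {[(True, a)]}
        = \<one>\<^bsub>env_group G\<^esub>"
      using a by (simp add: env_mult_class env_one_class env_class_eq_iff env_l_inv)
    then have "env_rel G `` {[(False, a)]} = inv\<^bsub>env_group G\<^esub> env_emb G a"
      using pos neg by (simp add: env_emb_def U.inv_equality)
    then show ?thesis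
      using False eq[OF a] pos by (simp add: env_emb_def)
  qed (use eq[OF a] in \<open>simp add: env_emb_def\<close>)
  have "h (env_rel G `` {u}) = k (env_rel G `` {u})" if "u \<in> signed_words G" for u
    using that
  proof (induction u)
    case Nil
    then show ?case using h.hom_one k.hom_one by (simp add: env_one_class)
  next
    case (Cons p u)
    obtain s a where p: "p = (s, a)" by (cases p)
    have a: "a \<in> carrier G" and u: "u \<in> signed_words G" using Cons.prems p by auto
    have "env_rel G `` {p # u} = env_rel G `` {[(s, a)]} \<otimes>\<^bsub>env_group G\<^esub> env_rel G `` {u}"
      using a u p by (simp add: env_mult_class)
    then show ?case
      using Cons.IH[OF u] letter[OF a] a u by (simp add: env_class_closed)
  qed
  then show ?thesis using X by (auto elim!: env_carrierE)
qed

end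


section \<open>Multifractions\<close>

text \<open>A multifraction \<open>a\<^sub>1/\<cdots>/a\<^sub>n\<close> is the list \<open>[a\<^sub>1, \<dots>, a\<^sub>n]\<close>; its depth is the length.\<close>

abbreviation multifractions :: "('a, 'b) monoid_scheme \<Rightarrow> 'a list set" where
  "multifractions M \<equiv> lists (carrier M)"

fun alternating_prod :: "('g, 'h) monoid_scheme \<Rightarrow> bool \<Rightarrow> 'g list \<Rightarrow> 'g" where
  "alternating_prod G s [] = \<one>\<^bsub>G\<^esub>"
| "alternating_prod G s (g # gs) =
     (if s then g else inv\<^bsub>G\<^esub> g) \<otimes>\<^bsub>G\<^esub> alternating_prod G (\<not> s) gs"

definition represented :: "('a, 'b) monoid_scheme \<Rightarrow> 'a list \<Rightarrow> (bool \<times> 'a) list set" where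
  "represented M a = alternating_prod (env_group M) True (map (env_emb M) a)"

definition mf_mult :: "('a, 'b) monoid_scheme \<Rightarrow> 'a list \<Rightarrow> 'a list \<Rightarrow> 'a list" where
  "mf_mult M a b =
     (if a = [] then b
      else if b = [] then a
      else if even (length a) then a @ b
      else butlast a @ (last a \<otimes>\<^bsub>M\<^esub> hd b) # tl b)"

text \<open>Positions in a multifraction are numbered from 1, whereas list indices start from 0.\<close>

abbreviation entry :: "'a list \<Rightarrow> nat \<Rightarrow> 'a" where
  "entry a i \<equiv> a ! (i - 1)"

text \<open>
  \<open>reduce_at M i x a b\<close> says that \<open>b\<close> is the result of applying the rule \<open>R\<^sub>i\<^sub>,\<^sub>x\<close> to \<open>a\<close>; the two
  \<open>lcmof\<close> conditions say that the displayed common multiple is the right lcm, respectively the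
  left lcm, of \<open>x\<close> and the \<open>i\<close>-th entry.
\<close>

definition reduce_at ::
    "('a, 'b) monoid_scheme \<Rightarrow> nat \<Rightarrow> 'a \<Rightarrow> 'a list \<Rightarrow> 'a list \<Rightarrow> bool" where
  "reduce_at M i x a b \<longleftrightarrow>
     1 \<le> i \<and> x \<in> carrier M \<and> a \<in> multifractions M \<and> b \<in> multifractions M \<and>
     length b = length a \<and> i < length a \<and>
     (\<forall>k\<in>{1..length a} - {i - 1, i, i + 1}. entry b k = entry a k) \<and>
     (if i = 1 then
        entry b 1 \<otimes>\<^bsub>M\<^esub> x = entry a 1 \<and>
        entry b 2 \<otimes>\<^bsub>M\<^esub> x = entry a 2
      else if even i then
        (\<exists>x'\<in>carrier M.
           entry b (i - 1) = entry a (i - 1) \<otimes>\<^bsub>M\<^esub> x' \<and>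
           x \<otimes>\<^bsub>M\<^esub> entry b i = entry a i \<otimes>\<^bsub>M\<^esub> x' \<and>
           (entry a i \<otimes>\<^bsub>M\<^esub> x') lcmof\<^bsub>M\<^esub> x (entry a i) \<and>
           x \<otimes>\<^bsub>M\<^esub> entry b (i + 1) = entry a (i + 1))
      else
        (\<exists>x'\<in>carrier M.
           entry b (i - 1) = x' \<otimes>\<^bsub>M\<^esub> entry a (i - 1) \<and>
           entry b i \<otimes>\<^bsub>M\<^esub> x = x' \<otimes>\<^bsub>M\<^esub> entry a i \<and>
           (x' \<otimes>\<^bsub>M\<^esub> entry a i) lcmof\<^bsub>opposite M\<^esub> x (entry a i) \<and>
           entry b (i + 1) \<otimes>\<^bsub>M\<^esub> x = entry a (i + 1)))"

inductive mf_step :: "('a, 'b) monoid_scheme \<Rightarrow> 'a list \<Rightarrow> 'a list \<Rightarrow> bool"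
  for M (structure) where
  reduce: "x \<noteq> \<one> \<Longrightarrow> reduce_at M i x a b \<Longrightarrow> mf_step M a b"
| trim: "a \<in> multifractions M \<Longrightarrow> mf_step M (a @ [\<one>]) a"

abbreviation mf_reduces :: "('a, 'b) monoid_scheme \<Rightarrow> 'a list \<Rightarrow> 'a list \<Rightarrow> bool" where
  "mf_reduces M \<equiv> (mf_step M)\<^sup>*\<^sup>*"

definition mf_irreducible :: "('a, 'b) monoid_scheme \<Rightarrow> 'a list \<Rightarrow> bool" where
  "mf_irreducible M a \<longleftrightarrow> a \<in> multifractions M \<and> (\<nexists>b. mf_step M a b)"

text \<open>Meaningful only where the irreducible reduct exists and is unique.\<close>

definition red :: "('a, 'b) monoid_scheme \<Rightarrow> 'a list \<Rightarrow> 'a list" where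
  "red M a = (THE b. mf_reduces M a b \<and> mf_irreducible M b)"

end

(*
  The reductions form a convergent rewrite system. They terminate because a rule at level i
  replaces the entry i + 1 by a proper factor and keeps the later entries, so that multifractions
  decrease lexicographically from the right. They are locally confluent: two rules R(i,x), R(i,y)
  are joined through R(i,z) with z the lcm of x and y, which applies by the 3-Ore condition;
  R(i,x) and R(i+1,y) are joined by a computation with lcms, followed by a division at level
  i - 1; all other pairs commute. Newman's lemma then gives unique normal forms. A reduction does
  not change the represented element. Conversely, the letters of the presentation of U(M) act on
  multifractions modulo reductions, and acting on the empty multifraction with the word of a
  yields a, so multifractions that represent the same element are equivalent.
*)
theory Submission
  imports Defs "HOL-Library.Confluence"
begin

text \<open>Rules at even and odd levels mirror each other, so each lcm argument is made once, in
  \<open>M\<close> or its opposite, and lists are treated by recursion on suffixes that remember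
  only the parity of their head. The obstacle is the left end: \<open>R(1,x)\<close> has no entry to
  receive a cofactor and no lower level at which a division could correct the result. It is treated
  as an instance of the general rule with cofactor \<open>\<one>\<close>; since a factor of
  \<open>\<one>\<close> is \<open>\<one>\<close>, the correcting division for levels 1 and 2 is
  trivial. Trimming is kept apart, because no rule can divide a last entry equal to
  \<open>\<one>\<close>. On the group side, the presentation offers no invariant that separates
  elements, hence the action; it is taken modulo the generated equivalence rather than on
  irreducible multifractions, so that it needs neither termination nor confluence, which enter only
  at the end.\<close>

section \<open>Symmetry under passage to the opposite monoid\<close>

lemma divides_opposite_opposite [simp]:
  "a divides\<^bsub>opposite (opposite M)\<^esub> b \<longleftrightarrow> a divides\<^bsub>M\<^esub> b"
  by (simp add: factor_def)

lemma lcmof_opposite_opposite [simp]: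
  "m lcmof\<^bsub>opposite (opposite M)\<^esub> a b \<longleftrightarrow> m lcmof\<^bsub>M\<^esub> a b"
  by (simp add: islcm_def)

lemma gcdof_opposite_opposite [simp]:
  "d gcdof\<^bsub>opposite (opposite M)\<^esub> a b \<longleftrightarrow> d gcdof\<^bsub>M\<^esub> a b"
  by (simp add: isgcd_def)

lemma properfactor_opposite_opposite [simp]:
  "properfactor (opposite (opposite M)) = properfactor M"
  by (simp add: properfactor_def fun_eq_iff)

lemma opposite_involutive: "opposite (opposite G) = G" for G :: "'a monoid"
  by (simp add: opposite_def)

lemma three_ore_opposite: "three_ore M \<Longrightarrow> three_ore (opposite M)"
  by (simp add: three_ore_def right_three_ore_def have_common_right_multiple_def)

lemma noetherian_opposite: "noetherian M \<Longrightarrow> noetherian (opposite M)"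
  by (simp add: noetherian_def)

lemma (in gcd_monoid) gcd_monoid_opposite: "gcd_monoid (opposite M)"
proof
  have "Units (opposite M) = Units M"
    by (auto simp: Units_def)
  then show "Units (opposite M) = {\<one>\<^bsub>opposite M\<^esub>}"
    by (simp add: Units_trivial)
next
  fix a b c
  assume "a \<in> carrier (opposite M)" "b \<in> carrier (opposite M)" "c \<in> carrier (opposite M)"
  then show "c \<otimes>\<^bsub>opposite M\<^esub> a = c \<otimes>\<^bsub>opposite M\<^esub> b \<Longrightarrow> a = b"
    and "a \<otimes>\<^bsub>opposite M\<^esub> c = b \<otimes>\<^bsub>opposite M\<^esub> c \<Longrightarrow> a = b"
    by (auto dest: l_cancel r_cancel)
qed (auto simp: m_assoc intro: left_gcd_exists right_gcd_exists)

section \<open>Least common multiples\<close>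

context gcd_monoid
begin

lemma prod_one_imp_one:
  assumes "a \<in> carrier M" "b \<in> carrier M" "a \<otimes> b = \<one>"
  shows "a = \<one>" "b = \<one>"
proof -
  have "b \<otimes> a \<otimes> b = \<one> \<otimes> b"
    using assms by (simp add: m_assoc)
  then have "b \<otimes> a = \<one>"
    using assms r_cancel by blast
  then have "a \<in> Units M" "b \<in> Units M"
    using assms by (auto simp: Units_def)
  then show "a = \<one>" "b = \<one>"
    using Units_trivial by auto
qed

lemma prod_eq_self_imp_one:
  assumes "a \<in> carrier M" "b \<in> carrier M" "a \<otimes> b = a"
  shows "b = \<one>"
  using assms by (metis l_cancel one_closed r_one)

text \<open>
  Dividing a common multiple \<open>x p = y q\<close> by the right gcd of \<open>p\<close> and \<open>q\<close> yields the right lcm: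
  its left gcd with any other common multiple leaves a common right divisor of the cofactors.
\<close>

lemma lcm_exists:
  assumes x: "x \<in> carrier M" and y: "y \<in> carrier M" and m: "m \<in> carrier M"
    and xm: "x divides m" and ym: "y divides m"
  obtains n where "n \<in> carrier M" "n lcmof x y"
proof -
  obtain p q where p: "p \<in> carrier M" "m = x \<otimes> p" and q: "q \<in> carrier M" "m = y \<otimes> q"
    using xm ym by (auto simp: factor_def)
  obtain d where d: "d \<in> carrier M" "d gcdof\<^bsub>opposite M\<^esub> p q"
    using right_gcd_exists p q by blast
  then obtain p' q' where p': "p' \<in> carrier M" "p = p' \<otimes> d"
    and q': "q' \<in> carrier M" "q = q' \<otimes> d"
    by (auto simp: isgcd_def divides_opposite_iff)
  have eq: "x \<otimes> p' = y \<otimes> q'"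
  proof -
    have "x \<otimes> p' \<otimes> d = y \<otimes> q' \<otimes> d"
      using p q p' q' x y d by (simp add: m_assoc)
    then show ?thesis using d p' q' x y r_cancel by blast
  qed
  have "x \<otimes> p' divides n" if n: "n \<in> carrier M" "x divides n" "y divides n" for n
  proof -
    obtain g where g: "g \<in> carrier M" "g gcdof (x \<otimes> p') n"
      using left_gcd_exists[of "x \<otimes> p'" n] x p' n by auto
    have "x divides g" "y divides g"
      using g n x y p' q' eq unfolding isgcd_def by (metis dividesI)+
    then obtain e f where e: "e \<in> carrier M" "g = x \<otimes> e" and f: "f \<in> carrier M" "g = y \<otimes> f"
      by (auto simp: factor_def)
    obtain h where h: "h \<in> carrier M" "x \<otimes> p' = g \<otimes> h"
      using g by (auto simp: isgcd_def factor_def)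
    have "x \<otimes> p' = x \<otimes> (e \<otimes> h)" "y \<otimes> q' = y \<otimes> (f \<otimes> h)"
      using h e f x y eq by (simp_all add: m_assoc[symmetric])
    then have "p' = e \<otimes> h" "q' = f \<otimes> h"
      using l_cancel x y e f h p' q' by blast+
    then have "p = e \<otimes> (h \<otimes> d)" "q = f \<otimes> (h \<otimes> d)"
      using p' q' e f h d by (simp_all add: m_assoc)
    then have "(h \<otimes> d) divides\<^bsub>opposite M\<^esub> d"
      using d e f h by (auto simp: isgcd_def divides_opposite_iff)
    then obtain k where k: "k \<in> carrier M" "d = k \<otimes> (h \<otimes> d)"
      by (auto simp: divides_opposite_iff)
    then have "\<one> \<otimes> d = (k \<otimes> h) \<otimes> d"
      using d h by (simp add: m_assoc)
    then have "k \<otimes> h = \<one>"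
      using k h d r_cancel by (metis m_closed one_closed)
    then have "h = \<one>"
      using prod_one_imp_one k h by blast
    then show ?thesis using h g by (simp add: isgcd_def)
  qed
  then have "(x \<otimes> p') lcmof x y"
    using eq x y p' q' by (auto simp: islcm_def intro: dividesI)
  then show ?thesis using that x p' by blast
qed

end

section \<open>Local reductions\<close>

text \<open>
  The rule \<open>R\<^sub>i\<^sub>,\<^sub>x\<close> for even \<open>i\<close>, on the entries \<open>v = a\<^sub>i\<close> and \<open>w = a\<^sub>i\<^sub>+\<^sub>1\<close>, multiplies \<open>a\<^sub>i\<^sub>-\<^sub>1\<close> by \<open>x'\<close>
  on the right. The rule for odd \<open>i\<close> is the same rule in the opposite monoid, and \<open>R\<^sub>1\<^sub>,\<^sub>x\<close> is the
  case \<open>x' = \<one>\<close>.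
\<close>

definition local_red ::
    "('a, 'b) monoid_scheme \<Rightarrow> 'a \<Rightarrow> 'a \<Rightarrow> 'a \<Rightarrow> 'a \<Rightarrow> 'a \<Rightarrow> 'a \<Rightarrow> bool" where
  "local_red G x x' v w v' w' \<longleftrightarrow>
     {x, x', v, w, v', w'} \<subseteq> carrier G \<and> x \<otimes>\<^bsub>G\<^esub> v' = v \<otimes>\<^bsub>G\<^esub> x' \<and>
     (v \<otimes>\<^bsub>G\<^esub> x') lcmof\<^bsub>G\<^esub> x v \<and> x \<otimes>\<^bsub>G\<^esub> w' = w"

context gcd_monoid
begin

lemma local_red_closed:
  assumes "local_red M x x' v w v' w'"
  shows "x \<in> carrier M" "x' \<in> carrier M" "v \<in> carrier M" "w \<in> carrier M"
    "v' \<in> carrier M" "w' \<in> carrier M"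
  using assms by (auto simp: local_red_def)

lemma local_red_eqs:
  assumes "local_red M x x' v w v' w'"
  shows "x \<otimes> v' = v \<otimes> x'" "x \<otimes> w' = w"
  using assms by (auto simp: local_red_def)

lemma local_red_exists:
  assumes "x \<in> carrier M" "v \<in> carrier M" "w' \<in> carrier M" "m \<in> carrier M"
    and "x divides m" "v divides m"
  obtains x' v' where "local_red M x x' v (x \<otimes> w') v' w'"
proof -
  obtain n where n: "n \<in> carrier M" "n lcmof x v"
    using lcm_exists assms by metis
  then obtain v' x' where "v' \<in> carrier M" "n = x \<otimes> v'" "x' \<in> carrier M" "n = v \<otimes> x'"
    by (auto simp: islcm_def factor_def)
  then have "local_red M x x' v (x \<otimes> w') v' w'"
    using n assms by (simp add: local_red_def)
  then show ?thesis using that by blast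
qed

text \<open>The element \<open>x \<otimes> p = v \<otimes> q\<close> is a common right multiple of
  \<open>x\<close> and \<open>v\<close>, hence a right multiple of the lcm
  \<open>v \<otimes> x'\<close>; cancellation then shows that the same \<open>t\<close> completes
  both cofactors.\<close>

lemma local_red_dvd:
  assumes T: "local_red M x x' v w v' w'" and "p \<in> carrier M" "q \<in> carrier M" "x \<otimes> p = v \<otimes> q"
  obtains t where "t \<in> carrier M" "q = x' \<otimes> t" "p = v' \<otimes> t"
proof -
  note c = local_red_closed[OF T]
  have "v \<otimes> x' divides v \<otimes> q"
    using T assms unfolding local_red_def islcm_def
    by (metis dividesI m_closed insert_subset)
  then obtain t where t: "t \<in> carrier M" "v \<otimes> q = v \<otimes> x' \<otimes> t"
    by (auto simp: factor_def)
  have "v \<otimes> q = v \<otimes> (x' \<otimes> t)"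
    using t c by (simp add: m_assoc)
  then have "q = x' \<otimes> t" using c t assms l_cancel by blast
  moreover have "x \<otimes> p = x \<otimes> (v' \<otimes> t)"
    using t c assms local_red_eqs[OF T] by (simp add: m_assoc[symmetric])
  then have "p = v' \<otimes> t" using c t assms l_cancel by blast
  ultimately show ?thesis using that t by blast
qed

text \<open>Converse to \<open>local_red_dvd\<close>: every common multiple has the form
  \<open>v \<otimes> q\<close>, so leastness need only be tested on the cofactor of
  \<open>v\<close>.\<close>

lemma local_redI:
  assumes "{x, x', v, w', v'} \<subseteq> carrier M" "x \<otimes> v' = v \<otimes> x'" "w = x \<otimes> w'"
    and "\<And>p q. p \<in> carrier M \<Longrightarrow> q \<in> carrier M \<Longrightarrow> x \<otimes> p = v \<otimes> q \<Longrightarrow> x' divides q"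
  shows "local_red M x x' v w v' w'"
proof -
  have "v \<otimes> x' divides y" if y: "y \<in> carrier M" "x divides y" "v divides y" for y
  proof -
    obtain p q where "p \<in> carrier M" "q \<in> carrier M" "y = x \<otimes> p" "y = v \<otimes> q"
      using y by (auto simp: factor_def)
    then show ?thesis using assms by (metis divides_mult_lI insert_subset)
  qed
  then have "(v \<otimes> x') lcmof x v"
    using assms unfolding islcm_def by (metis dividesI insert_subset)
  then show ?thesis using assms unfolding local_red_def by auto
qed

text \<open>When \<open>x\<close> divides \<open>v\<close>, the lcm is \<open>v\<close> itself, and
  nothing is passed to the entry on the left.\<close>

lemma local_red_trivial:
  assumes T: "local_red M x x' v w v' w'" and p: "p \<in> carrier M" "v = x \<otimes> p"
  shows "x' = \<one>" "v' = p"
proof -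
  note c = local_red_closed[OF T]
  obtain t where "t \<in> carrier M" "\<one> = x' \<otimes> t" "p = v' \<otimes> t"
    using local_red_dvd[OF T, of p \<one>] p c by auto
  then show "x' = \<one>" "v' = p"
    using c by (metis prod_one_imp_one r_one)+
qed

lemma local_red_one:
  assumes "local_red M \<one> x' v w v' w'"
  shows "x' = \<one>" "v' = v" "w' = w"
  using local_red_trivial[OF assms, of v] local_red_closed[OF assms] local_red_eqs[OF assms]
  by auto

lemma local_red_divide:
  assumes "x \<in> carrier M" "v' \<in> carrier M" "w' \<in> carrier M"
  shows "local_red M x \<one> (x \<otimes> v') (x \<otimes> w') v' w'"
  using assms by (intro local_redI) (auto intro: dividesI[OF _ l_one[symmetric]])

lemma local_red_right_one:
  assumes "local_red M x \<one> v w v' w'"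
  shows "v = x \<otimes> v'" "w = x \<otimes> w'"
  using local_red_closed[OF assms] local_red_eqs[OF assms] by auto

text \<open>Lets rules two levels apart commute: the one on the right multiplies \<open>w\<close> on
  the side opposite to the one where \<open>x\<close> is split off.\<close>

lemma local_red_mult:
  assumes T: "local_red M x x' v w v' w'" and y: "y \<in> carrier M"
  shows "local_red M x x' v (w \<otimes> y) v' (w' \<otimes> y)"
  using T y local_red_eqs[OF T] local_red_closed[OF T] unfolding local_red_def
  by (auto simp: m_assoc[symmetric])

text \<open>The lcm of \<open>x \<otimes> t\<close> and \<open>v\<close> can be built in two stages,
  from \<open>x\<close> and \<open>v\<close> first and then from \<open>t\<close> and the residue
  \<open>v1\<close>. This is how reductions by \<open>x\<close> and by \<open>y\<close> both extend
  to a reduction by their lcm.\<close>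

lemma local_red_factor:
  assumes T: "local_red M x x' v w v1 w1" and z: "local_red M (x \<otimes> t) z' v w v2 w2"
    and t: "t \<in> carrier M"
  obtains t' where "local_red M t t' v1 w1 v2 w2" "z' = x' \<otimes> t'"
proof -
  note c = local_red_closed[OF T] local_red_closed[OF z]
  have eqz: "x \<otimes> (t \<otimes> v2) = v \<otimes> z'"
    using local_red_eqs[OF z] c t by (simp add: m_assoc)
  then obtain t' where t': "t' \<in> carrier M" "z' = x' \<otimes> t'" "t \<otimes> v2 = v1 \<otimes> t'"
    using local_red_dvd[OF T, of "t \<otimes> v2" z'] c t by auto
  have "local_red M t t' v1 w1 v2 w2"
  proof (rule local_redI)
    have "x \<otimes> w1 = x \<otimes> (t \<otimes> w2)"
      using local_red_eqs(2)[OF z] local_red_eqs(2)[OF T] c t by (simp add: m_assoc)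
    then show "w1 = t \<otimes> w2"
      using l_cancel c t by blast
    fix p q assume pq: "p \<in> carrier M" "q \<in> carrier M" "t \<otimes> p = v1 \<otimes> q"
    have "x \<otimes> t \<otimes> p = x \<otimes> v1 \<otimes> q"
      using pq c t by (simp add: m_assoc)
    also have "\<dots> = v \<otimes> (x' \<otimes> q)"
      using local_red_eqs[OF T] pq c t by (simp add: m_assoc)
    finally obtain s where "s \<in> carrier M" "x' \<otimes> q = z' \<otimes> s"
      using local_red_dvd[OF z pq(1) m_closed[OF c(2) pq(2)]] by metis
    then have "x' \<otimes> q = x' \<otimes> (t' \<otimes> s)"
      using t' c by (simp add: m_assoc)
    then show "t' divides q"
      using l_cancel c t' pq \<open>s \<in> carrier M\<close> by (metis dividesI m_closed)
  qed (use c t t' in auto)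
  then show ?thesis using that t' by blast
qed

text \<open>The only place where the 3-Ore condition enters.\<close>

lemma local_red_same:
  assumes ore: "right_three_ore M"
    and T: "local_red M x x' v w v1 w1" and S: "local_red M y y' v w v2 w2"
  obtains s s' t t' v3 w3 where "local_red M s s' v1 w1 v3 w3" "local_red M t t' v2 w2 v3 w3"
    "x' \<otimes> s' = y' \<otimes> t'" "x' = \<one> \<Longrightarrow> y' = \<one> \<Longrightarrow> s' = \<one> \<and> t' = \<one>"
proof -
  note c = local_red_closed[OF T] local_red_closed[OF S]
  have dw: "x divides w" "y divides w"
    using local_red_eqs[OF T] local_red_eqs[OF S] c by (metis dividesI)+
  then obtain z where z: "z \<in> carrier M" "z lcmof x y"
    using lcm_exists c by metis
  obtain s t where s: "s \<in> carrier M" "z = x \<otimes> s" and t: "t \<in> carrier M" "z = y \<otimes> t"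
    using z by (auto simp: islcm_def factor_def)
  obtain w3 where w3: "w3 \<in> carrier M" "w = z \<otimes> w3"
    using z dw c by (auto simp: islcm_def factor_def)
  \<comment> \<open>The lcms required by the two rules supply the pairs with \<open>v\<close>; the
    entry \<open>w\<close>, divisible by both \<open>x\<close> and \<open>y\<close>, supplies the
    third pair.\<close>
  have "have_common_right_multiple M {x, v}" "have_common_right_multiple M {y, v}"
    "have_common_right_multiple M {x, y}"
    using T S dw c m_closed[of v x'] m_closed[of v y']
    unfolding local_red_def islcm_def have_common_right_multiple_def by auto
  then have "have_common_right_multiple M {x, y, v}"
    using ore c unfolding right_three_ore_def by blast
  then obtain m where m: "m \<in> carrier M" "x divides m" "y divides m" "v divides m"
    by (auto simp: have_common_right_multiple_def)
  have zm: "z divides m"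
    using z m by (auto simp: islcm_def)
  obtain z' v3 where Z: "local_red M z z' v w v3 w3"
    using local_red_exists[OF z(1) c(3) w3(1) m(1) zm m(4)] w3 by metis
  obtain s' where s': "local_red M s s' v1 w1 v3 w3" "z' = x' \<otimes> s'"
    using local_red_factor T Z s by metis
  obtain t' where t': "local_red M t t' v2 w2 v3 w3" "z' = y' \<otimes> t'"
    using local_red_factor S Z t by metis
  \<comment> \<open>Needed for two divisions at the head of a list, where no entry can receive a
    cofactor: \<open>x\<close> and \<open>y\<close> then both divide \<open>v\<close>, and so does
    their lcm.\<close>
  have "s' = \<one> \<and> t' = \<one>" if "x' = \<one>" "y' = \<one>"
  proof -
    have "x divides v" "y divides v"
      using that local_red_right_one T S c by (metis dividesI)+
    then obtain p where "p \<in> carrier M" "v = z \<otimes> p"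
      using z c by (auto simp: islcm_def factor_def)
    then have "z' = \<one>" using local_red_trivial[OF Z] by blast
    then show ?thesis
      using s' t' that local_red_closed[OF s'(1)] local_red_closed[OF t'(1)] by auto
  qed
  then show ?thesis using that s' t' by metis
qed

text \<open>Take \<open>u/v/w/s\<close> with \<open>v\<close> at an even level. The rules by
  \<open>x\<close> at \<open>v\<close> and by \<open>y\<close> at \<open>w\<close> give
  \<open>ux'/v1/w1/s\<close> and \<open>u/y'v/w2/s2\<close>. The former continues by
  \<open>y\<close> at \<open>w1\<close> to \<open>ux'/y''v1/w3/s2\<close>, the latter by
  \<open>z\<close> at \<open>y'v\<close> to \<open>uz'/v2/w3/s2\<close>; the former result has an
  extra right factor \<open>t\<close> in its first two entries.\<close>

lemma local_red_adjacent:
  assumes T: "local_red M x x' v w v1 w1" and S: "local_red (opposite M) y y' w s w2 s2"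
  obtains y'' z z' t w3 v2 where "local_red (opposite M) y y'' w1 s w3 s2"
    "local_red M z z' (y' \<otimes> v) w2 v2 w3" "t \<in> carrier M" "x' = z' \<otimes> t" "y'' \<otimes> v1 = v2 \<otimes> t"
proof -
  interpret op: gcd_monoid "opposite M" by (rule gcd_monoid_opposite)
  note c = local_red_closed[OF T] op.local_red_closed[OF S, simplified]
  note eT = local_red_eqs[OF T] and eS = op.local_red_eqs[OF S, simplified]
  \<comment> \<open>As \<open>w = x \<otimes> w1\<close>, the common left multiple of
    \<open>y\<close> and \<open>w\<close> is also one of \<open>y\<close> and \<open>w1\<close>, so
    the rule by \<open>y\<close> still applies after the rule by \<open>x\<close>.\<close>
  have lcm: "w2 \<otimes> y = (y' \<otimes> x) \<otimes> w1"
    using c eT eS by (simp add: m_assoc)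
  obtain y'' w3 where Y: "local_red (opposite M) y y'' w1 (s2 \<otimes> y) w3 s2"
  proof (rule op.local_red_exists[of y w1 s2 "w2 \<otimes> y"])
    show "y divides\<^bsub>opposite M\<^esub> w2 \<otimes> y" "w1 divides\<^bsub>opposite M\<^esub> w2 \<otimes> y"
      using c lcm unfolding divides_opposite_iff by blast+
  qed (use c in auto)
  note cY = op.local_red_closed[OF Y, simplified]
  obtain z where z: "z \<in> carrier M" "y' \<otimes> x = z \<otimes> y''" "w2 = z \<otimes> w3"
    using op.local_red_dvd[OF Y, of w2 "y' \<otimes> x"] c lcm by auto
  \<comment> \<open>Here \<open>z\<close> is what is left of \<open>x\<close> after \<open>y\<close>
    has acted; the equation gives \<open>z\<close> and \<open>y' \<otimes> v\<close> a common right
    multiple, so the rule by \<open>z\<close> applies.\<close>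
  have com: "z \<otimes> (y'' \<otimes> v1) = (y' \<otimes> v) \<otimes> x'"
    using z c cY eT by (metis m_assoc)
  then obtain z' v2 where Z: "local_red M z z' (y' \<otimes> v) (z \<otimes> w3) v2 w3"
    using local_red_exists[of z "y' \<otimes> v" w3 "z \<otimes> (y'' \<otimes> v1)"] c cY z
    by (metis dividesI m_closed)
  obtain t where "t \<in> carrier M" "x' = z' \<otimes> t" "y'' \<otimes> v1 = v2 \<otimes> t"
    using local_red_dvd[OF Z, of "y'' \<otimes> v1" x'] com c cY by auto
  then show ?thesis using that Y Z z eS by metis
qed

end


section \<open>Reductions of multifractions\<close>

text \<open>The double opposite stands for \<open>M\<close> itself: \<open>opposite\<close> returns
  a plain \<open>monoid\<close> record, which gives both sides the same type even if
  \<open>M\<close> has extra fields. Rules at even levels use \<open>side M True\<close>, those at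
  odd levels \<open>side M False\<close>.\<close>

definition side :: "('a, 'b) monoid_scheme \<Rightarrow> bool \<Rightarrow> 'a monoid" where
  "side M p = (if p then opposite (opposite M) else opposite M)"

lemma carrier_side [simp]: "carrier (side M p) = carrier M"
  and one_side [simp]: "\<one>\<^bsub>side M p\<^esub> = \<one>\<^bsub>M\<^esub>"
  by (simp_all add: side_def)

lemma mult_side: "a \<otimes>\<^bsub>side M p\<^esub> b = (if p then a \<otimes>\<^bsub>M\<^esub> b else b \<otimes>\<^bsub>M\<^esub> a)"
  by (simp add: side_def)

lemma opposite_side: "opposite (side M p) = side M (\<not> p)"
  by (simp add: side_def opposite_involutive)

lemma right_three_ore_side: "three_ore M \<Longrightarrow> right_three_ore (side M p)"
  using three_ore_opposite[of M] three_ore_opposite[of "opposite M"]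
  by (auto simp: side_def three_ore_def)

lemma noetherian_side: "noetherian M \<Longrightarrow> noetherian (side M p)"
  by (simp add: side_def noetherian_opposite)

lemma (in gcd_monoid) gcd_monoid_side: "gcd_monoid (side M p)"
  unfolding side_def by (metis gcd_monoid_opposite gcd_monoid.gcd_monoid_opposite)

text \<open>
  A list is read with its first entry in an odd position if \<open>p\<close> holds, and in an even one
  otherwise.
\<close>

inductive inner_red :: "('a, 'b) monoid_scheme \<Rightarrow> bool \<Rightarrow> 'a list \<Rightarrow> 'a list \<Rightarrow> bool"
  for M (structure) where
  here: "\<lbrakk>local_red (side M p) x x' v w v' w'; x \<noteq> \<one>; u \<in> carrier M; r \<in> multifractions M\<rbrakk> \<Longrightarrow>
    inner_red M p (u # v # w # r) ((u \<otimes>\<^bsub>side M p\<^esub> x') # v' # w' # r)"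
| there: "inner_red M (\<not> p) a b \<Longrightarrow> c \<in> carrier M \<Longrightarrow> inner_red M p (c # a) (c # b)"

text \<open>Division at the head is allowed for both parities, although only \<open>p = True\<close>
  corresponds to \<open>R(1,x)\<close>: a suffix then behaves like a whole list, and under a prefix
  the division becomes an inner rule with cofactor \<open>\<one>\<close>. Trimming is not
  included.\<close>

inductive red_step :: "('a, 'b) monoid_scheme \<Rightarrow> bool \<Rightarrow> 'a list \<Rightarrow> 'a list \<Rightarrow> bool"
  for M (structure) where
  divide: "\<lbrakk>local_red (side M (\<not> p)) x \<one> v w v' w'; x \<noteq> \<one>; r \<in> multifractions M\<rbrakk> \<Longrightarrow>
    red_step M p (v # w # r) (v' # w' # r)"
| inner: "inner_red M p a b \<Longrightarrow> red_step M p a b"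

definition joinable :: "('c \<Rightarrow> 'c \<Rightarrow> bool) \<Rightarrow> 'c \<Rightarrow> 'c \<Rightarrow> bool" where
  "joinable R b c \<longleftrightarrow> (\<exists>d. R\<^sup>*\<^sup>* b d \<and> R\<^sup>*\<^sup>* c d)"

lemma joinable_sym: "joinable R b c \<Longrightarrow> joinable R c b"
  by (auto simp: joinable_def)

context gcd_monoid
begin

interpretation side: gcd_monoid "side M p" for p
  by (rule gcd_monoid_side)

lemma inner_red_closed:
  "inner_red M p a b \<Longrightarrow> a \<in> multifractions M \<and> b \<in> multifractions M"
proof (induction rule: inner_red.induct)
  case (here p x x' v w v' w' u r)
  then show ?case
    using side.local_red_closed[OF here(1)] side.m_closed[of u p x'] by simp
qed auto

lemma red_step_closed:
  "red_step M p a b \<Longrightarrow> a \<in> multifractions M \<and> b \<in> multifractions M"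
proof (induction rule: red_step.induct)
  case (divide p x v w v' w' r)
  then show ?case using side.local_red_closed[OF divide(1)] by simp
qed (use inner_red_closed in blast)

lemma red_step_Cons:
  assumes "red_step M (\<not> p) a b" "c \<in> carrier M"
  shows "inner_red M p (c # a) (c # b)"
  using assms(1)
proof cases
  case (divide x v w v' w' r)
  then show ?thesis
    using inner_red.here[of M p x \<one> v w v' w' c r] assms(2) side.r_one[of c p] by simp
qed (use assms in \<open>auto intro: inner_red.there\<close>)

lemma red_steps_Cons:
  assumes "(red_step M (\<not> p))\<^sup>*\<^sup>* a b" "c \<in> carrier M"
  shows "(red_step M p)\<^sup>*\<^sup>* (c # a) (c # b)"
  using assms(1)
  by (induction rule: rtranclp_induct)
     (auto intro: rtranclp.rtrancl_into_rtrancl red_step.inner red_step_Cons assms(2))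

lemma joinable_Cons:
  "joinable (red_step M (\<not> p)) a b \<Longrightarrow> c \<in> carrier M \<Longrightarrow>
    joinable (red_step M p) (c # a) (c # b)"
  unfolding joinable_def by (meson red_steps_Cons)

text \<open>Admits \<open>x = \<one>\<close>, when nothing changes, because the elements produced by
  lcm computations may be trivial.\<close>

lemma red_steps_here:
  assumes T: "local_red (side M p) x x' v w v' w'"
    and "u \<in> carrier M" "r \<in> multifractions M"
  shows "(red_step M p)\<^sup>*\<^sup>* (u # v # w # r) ((u \<otimes>\<^bsub>side M p\<^esub> x') # v' # w' # r)"
proof (cases "x = \<one>")
  case True
  then show ?thesis
    using side.local_red_one[of p x' v w v' w'] T assms(2) side.r_one[of u p] by simp
next
  case False
  then show ?thesis using red_step.inner[OF inner_red.here[OF T False assms(2,3)]] by blast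
qed

lemma red_steps_divide:
  assumes T: "local_red (side M (\<not> p)) x \<one> v w v' w'" and "r \<in> multifractions M"
  shows "(red_step M p)\<^sup>*\<^sup>* (v # w # r) (v' # w' # r)"
proof (cases "x = \<one>")
  case True
  then show ?thesis
    using side.local_red_one[of "\<not> p" \<one> v w v' w'] T by simp
next
  case False
  then show ?thesis using red_step.divide[OF T False assms(2)] by blast
qed

section \<open>Local confluence of the rules other than trimming\<close>

text \<open>
  In the critical case, where \<open>c'\<close> comes from the rule one place to the right of \<open>x\<close>, the two
  sides can only be reconciled up to \<open>t\<close>, which is removed afterwards by a division one place to
  the left.
\<close>

lemma local_red_inner_red:
  assumes T: "local_red (side M p) x x' v w v1 w1" and c': "inner_red M (\<not> p) (v # w # r) c'"
  obtains z z' t v0 w0 v2 w2 r2 where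
    "c' = v0 # w0 # r2" "r2 \<in> multifractions M" "t \<in> carrier M"
    "local_red (side M p) z z' v0 w0 v2 w2" "x' = z' \<otimes>\<^bsub>side M p\<^esub> t"
    "(red_step M (\<not> p))\<^sup>*\<^sup>* (v1 # w1 # r) ((v2 \<otimes>\<^bsub>side M p\<^esub> t) # w2 # r2)"
  using c'
proof cases
  note c = side.local_red_closed[OF T, simplified]
  case (here y y' s w2 s2 r')
  obtain y'' z z' t w3 v2 where *: "local_red (opposite (side M p)) y y'' w1 s w3 s2"
    "local_red (side M p) z z' (y' \<otimes>\<^bsub>side M p\<^esub> v) w2 v2 w3" "t \<in> carrier (side M p)"
    "x' = z' \<otimes>\<^bsub>side M p\<^esub> t" "y'' \<otimes>\<^bsub>side M p\<^esub> v1 = v2 \<otimes>\<^bsub>side M p\<^esub> t"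
    using here(3)[folded opposite_side] by (rule side.local_red_adjacent[OF T]) (rule that)
  have m: "a \<otimes>\<^bsub>side M (\<not> p)\<^esub> b = b \<otimes>\<^bsub>side M p\<^esub> a" for a b
    by (simp add: mult_side)
  have "(red_step M (\<not> p))\<^sup>*\<^sup>* (v1 # w1 # r) ((v2 \<otimes>\<^bsub>side M p\<^esub> t) # w3 # s2 # r')"
    using red_steps_here[of "\<not> p" y y'' w1 s w3 s2 v1 r'] *(1,5) here c
    by (simp add: m opposite_side)
  moreover have "s2 # r' \<in> multifractions M"
    using here side.local_red_closed[OF here(3)] by simp
  ultimately show ?thesis
    using that * here by (simp add: m)
next
  note c = side.local_red_closed[OF T, simplified]
  case (there b)
  from there(2) have "inner_red M p (w # r) b" by simp
  then show ?thesis
  proof cases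
    \<comment> \<open>Two places to the right: \<open>w\<close> is shared, but multiplied and
      divided on opposite sides, so \<open>t = \<one>\<close>.\<close>
    case (here y y' s k s2 k2 r')
    note cy = side.local_red_closed[OF here(3), simplified]
    have "(red_step M p)\<^sup>*\<^sup>* (w1 # r) ((w1 \<otimes>\<^bsub>side M p\<^esub> y') # s2 # k2 # r')"
      using red_steps_here[of p y y' s k s2 k2 w1 r'] here c by simp
    then have "(red_step M (\<not> p))\<^sup>*\<^sup>* (v1 # w1 # r) (v1 # (w1 \<otimes>\<^bsub>side M p\<^esub> y') # s2 # k2 # r')"
      using red_steps_Cons[of "\<not> p"] c by simp
    moreover have "local_red (side M p) x x' v (w \<otimes>\<^bsub>side M p\<^esub> y') v1 (w1 \<otimes>\<^bsub>side M p\<^esub> y')"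
      using side.local_red_mult[OF T] cy by simp
    ultimately show ?thesis
      using that[of v "w \<otimes>\<^bsub>side M p\<^esub> y'" "s2 # k2 # r'" \<one> x x' v1 "w1 \<otimes>\<^bsub>side M p\<^esub> y'"]
        there here cy c side.r_one[of _ p] by simp
  next
    \<comment> \<open>Farther to the right: the rule acts within \<open>r\<close> only, so again
      \<open>t = \<one>\<close>.\<close>
    case (there b')
    then have "inner_red M p (w1 # r) (w1 # b')"
      using c by (auto intro: inner_red.there)
    then have "inner_red M (\<not> p) (v1 # w1 # r) (v1 # w1 # b')"
      using c inner_red.there[of M "\<not> p"] by simp
    then show ?thesis
      using that[of v w b' \<one> x x' v1 w1] T there inner_red_closed[OF there(2)]
        \<open>c' = v # b\<close> c side.r_one[of _ p]
      by (auto intro: red_step.inner)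
  qed
qed

lemma joinable_here_there:
  assumes T: "local_red (side M p) x x' v w v1 w1" and u: "u \<in> carrier M"
    and c': "inner_red M (\<not> p) (v # w # r) c'"
  shows "joinable (red_step M p) ((u \<otimes>\<^bsub>side M p\<^esub> x') # v1 # w1 # r) (u # c')"
proof -
  obtain z z' t v0 w0 v2 w2 r2 where *: "c' = v0 # w0 # r2" "r2 \<in> multifractions M" "t \<in> carrier M"
    "local_red (side M p) z z' v0 w0 v2 w2" "x' = z' \<otimes>\<^bsub>side M p\<^esub> t"
    "(red_step M (\<not> p))\<^sup>*\<^sup>* (v1 # w1 # r) ((v2 \<otimes>\<^bsub>side M p\<^esub> t) # w2 # r2)"
    using local_red_inner_red[OF T c'] by metis
  note c = side.local_red_closed[OF T, simplified] side.local_red_closed[OF *(4), simplified]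
  define e where "e = u \<otimes>\<^bsub>side M p\<^esub> z'"
  have e: "e \<in> carrier M" "u \<otimes>\<^bsub>side M p\<^esub> x' = e \<otimes>\<^bsub>side M p\<^esub> t"
    using u c * side.m_assoc[of u p z' t] side.m_closed[of u p z'] by (auto simp: e_def)
  have "e \<otimes>\<^bsub>side M p\<^esub> t \<in> carrier M"
    using e(1) *(3) side.m_closed[of e p t] by simp
  then have "(red_step M p)\<^sup>*\<^sup>* ((e \<otimes>\<^bsub>side M p\<^esub> t) # v1 # w1 # r)
      ((e \<otimes>\<^bsub>side M p\<^esub> t) # (v2 \<otimes>\<^bsub>side M p\<^esub> t) # w2 # r2)"
    using red_steps_Cons *(6) by blast
  \<comment> \<open>Both leading entries end in \<open>t\<close> when read in
    \<open>side M p\<close>, so the rule one level lower removes \<open>t\<close> with a trivial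
    cofactor.\<close>
  moreover have "local_red (side M (\<not> p)) t \<one> (e \<otimes>\<^bsub>side M p\<^esub> t) (v2 \<otimes>\<^bsub>side M p\<^esub> t) e v2"
    using side.local_red_divide[of t "\<not> p" e v2] *(3) e c by (cases p) (auto simp: mult_side)
  then have "(red_step M p)\<^sup>*\<^sup>* ((e \<otimes>\<^bsub>side M p\<^esub> t) # (v2 \<otimes>\<^bsub>side M p\<^esub> t) # w2 # r2)
      (e # v2 # w2 # r2)"
    by (rule red_steps_divide) (use c * in auto)
  ultimately have "(red_step M p)\<^sup>*\<^sup>* ((u \<otimes>\<^bsub>side M p\<^esub> x') # v1 # w1 # r) (e # v2 # w2 # r2)"
    using e by simp
  moreover have "(red_step M p)\<^sup>*\<^sup>* (u # c') (e # v2 # w2 # r2)"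
    unfolding e_def *(1) by (rule red_steps_here) (use * u in auto)
  ultimately show ?thesis unfolding joinable_def by blast
qed

text \<open>No lower level is available here to divide by \<open>t\<close>; but the cofactor of a
  division is \<open>\<one>\<close>, and its factor \<open>t\<close> must be \<open>\<one>\<close>
  too.\<close>

lemma joinable_divide_inner:
  assumes T: "local_red (side M (\<not> p)) x \<one> v w v1 w1" and c': "inner_red M p (v # w # r) c'"
  shows "joinable (red_step M p) (v1 # w1 # r) c'"
proof -
  obtain z z' t v0 w0 v2 w2 r2 where *: "c' = v0 # w0 # r2" "r2 \<in> multifractions M" "t \<in> carrier M"
    "local_red (side M (\<not> p)) z z' v0 w0 v2 w2" "\<one> = z' \<otimes>\<^bsub>side M (\<not> p)\<^esub> t"
    "(red_step M p)\<^sup>*\<^sup>* (v1 # w1 # r) ((v2 \<otimes>\<^bsub>side M (\<not> p)\<^esub> t) # w2 # r2)"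
    using local_red_inner_red[OF T, of r c'] c' by (metis (full_types))
  note c = side.local_red_closed[OF *(4), simplified]
  have "z' = \<one>" "t = \<one>"
    using side.prod_one_imp_one[of z' "\<not> p" t] * c by auto
  then show ?thesis
    using *(6,1) red_steps_divide[of p z v0 w0 v2 w2 r2] *(2,4) c side.r_one[of v2 "\<not> p"]
    unfolding joinable_def by auto
qed

lemma joinable_inner_red:
  assumes ore: "three_ore M"
  shows "inner_red M p a b \<Longrightarrow> inner_red M p a c \<Longrightarrow> joinable (red_step M p) b c"
proof (induction arbitrary: c rule: inner_red.induct)
  case (here p x x' v w v1 w1 u r)
  note T = here(1)
  from here(5) show ?case
  proof cases
    case S: (here y y' v2 w2)
    note c = side.local_red_closed[OF T, simplified] side.local_red_closed[OF S(2), simplified]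
    obtain s s' t t' v3 w3 where *: "local_red (side M p) s s' v1 w1 v3 w3"
      "local_red (side M p) t t' v2 w2 v3 w3" "x' \<otimes>\<^bsub>side M p\<^esub> s' = y' \<otimes>\<^bsub>side M p\<^esub> t'"
      by (rule side.local_red_same[OF right_three_ore_side[OF ore] T S(2)]) (rule that)
    note c = c side.local_red_closed[OF *(1), simplified] side.local_red_closed[OF *(2), simplified]
    have "(u \<otimes>\<^bsub>side M p\<^esub> x') \<otimes>\<^bsub>side M p\<^esub> s' = (u \<otimes>\<^bsub>side M p\<^esub> y') \<otimes>\<^bsub>side M p\<^esub> t'"
      using side.m_assoc[of u p x' s'] side.m_assoc[of u p y' t'] *(3) c \<open>u \<in> carrier M\<close> by simp
    then show ?thesis
      using red_steps_here[OF *(1), of "u \<otimes>\<^bsub>side M p\<^esub> x'" r]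
        red_steps_here[OF *(2), of "u \<otimes>\<^bsub>side M p\<^esub> y'" r]
        side.m_closed[of u p x'] side.m_closed[of u p y'] c here(3,4) S(1)
      unfolding joinable_def by auto
  next
    case (there b)
    then show ?thesis using joinable_here_there[OF T here(3)] by simp
  qed
next
  case (there p a b d)
  from there(4) show ?case
  proof cases
    case S: (here y y' v w v2 w2 r)
    then have "inner_red M (\<not> p) (v # w # r) b"
      using there(1) by simp
    then show ?thesis
      using joinable_here_there[OF S(3) there(2), of r b] S by (auto intro: joinable_sym)
  next
    case S: (there b')
    then show ?thesis using there joinable_Cons by blast
  qed
qed

lemma joinable_red_step:
  assumes ore: "three_ore M" and b: "red_step M p a b" and c: "red_step M p a c"
  shows "joinable (red_step M p) b c"
  using b
proof cases
  case T: (divide x v w v1 w1 r)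
  from c show ?thesis
  proof cases
    case S: (divide y v' w' v2 w2 r')
    then have S': "local_red (side M (\<not> p)) y \<one> v w v2 w2" "r' = r"
      using T(1) by auto
    obtain s s' t t' v3 w3 where *: "local_red (side M (\<not> p)) s s' v1 w1 v3 w3"
      "local_red (side M (\<not> p)) t t' v2 w2 v3 w3" "s' = \<one> \<and> t' = \<one>"
      using side.local_red_same[OF right_three_ore_side[OF ore] T(3) S'(1)] one_side by metis
    then show ?thesis
      using red_steps_divide[of p s v1 w1 v3 w3 r] red_steps_divide[of p t v2 w2 v3 w3 r] T S S'
      unfolding joinable_def by auto
  next
    case inner
    then show ?thesis using joinable_divide_inner[OF T(3), of r c] T by simp
  qed
next
  case b: inner
  from c show ?thesis
  proof cases
    case T: (divide x v w v1 w1 r)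
    then show ?thesis
      using joinable_divide_inner[OF T(3), of r b] b by (auto intro: joinable_sym)
  next
    case inner
    then show ?thesis using joinable_inner_red[OF ore b] by blast
  qed
qed

section \<open>Trailing trivial entries\<close>

text \<open>A rule that reaches the last entry would split off some \<open>x \<noteq> \<one>\<close>
  from \<open>\<one>\<close>, which is impossible without nontrivial invertible elements. So every
  rule keeps a final \<open>\<one>\<close> and also applies without it; this is why trimming
  commutes with the rules.\<close>

lemma inner_red_snoc_one:
  "inner_red M p a c \<Longrightarrow> a = b @ [\<one>] \<Longrightarrow> \<exists>d. c = d @ [\<one>] \<and> inner_red M p b d"
proof (induction arbitrary: b rule: inner_red.induct)
  case (here p x x' v w v' w' u r)
  show ?case
  proof (cases r rule: rev_cases)
    case Nil
    then have "x \<otimes>\<^bsub>side M p\<^esub> w' = \<one>"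
      using here side.local_red_eqs[OF here(1)] by simp
    then show ?thesis
      using side.prod_one_imp_one[of x p w'] side.local_red_closed[OF here(1)] here(2) by simp
  next
    case (snoc r' k)
    then have "b = u # v # w # r'" "k = \<one>" using here(5) by (auto simp: Cons_eq_append_conv)
    then show ?thesis using here snoc inner_red.here[OF here(1), of u r'] by auto
  qed
next
  case (there p a b' c)
  have "a \<noteq> []" using there(1) by (auto elim: inner_red.cases)
  then obtain b0 where "b = c # b0" "a = b0 @ [\<one>]"
    using there(4) by (auto simp: Cons_eq_append_conv)
  then show ?case using there inner_red.there by fastforce
qed

lemma red_step_snoc_one:
  assumes "red_step M p (b @ [\<one>]) c"
  shows "\<exists>d. c = d @ [\<one>] \<and> red_step M p b d"
  using assms
proof cases
  case (divide x v w v' w' r)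
  show ?thesis
  proof (cases r rule: rev_cases)
    case Nil
    then have "x \<otimes>\<^bsub>side M (\<not> p)\<^esub> w' = \<one>"
      using divide side.local_red_eqs[OF divide(3)] by (simp add: append_eq_Cons_conv)
    then show ?thesis
      using side.prod_one_imp_one[of x "\<not> p" w'] side.local_red_closed[OF divide(3)] divide(4)
      by simp
  next
    case (snoc r' k)
    then have "b = v # w # r'" "k = \<one>" using divide(1) by (auto simp: append_eq_Cons_conv)
    then show ?thesis
      using divide snoc red_step.divide[OF divide(3), of r'] by auto
  qed
next
  case inner
  then show ?thesis using inner_red_snoc_one by (blast intro: red_step.inner)
qed

end


section \<open>Rules given by positions and rules given by recursion on suffixes\<close>

lemma inner_red_append:
  "inner_red M (p \<longleftrightarrow> even (length e)) a b \<Longrightarrow> e \<in> multifractions M \<Longrightarrow>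
    inner_red M p (e @ a) (e @ b)"
proof (induction e arbitrary: p)
  case (Cons c e)
  then have "inner_red M ((\<not> p) \<longleftrightarrow> even (length e)) a b" by (cases p) auto
  then show ?case using Cons by (auto intro: inner_red.there)
qed simp

lemma inner_red_decomp:
  "inner_red M p a b \<Longrightarrow> \<exists>e u v w r x x' v' w'. e \<in> multifractions M \<and> x \<noteq> \<one>\<^bsub>M\<^esub> \<and>
    a = e @ u # v # w # r \<and>
    b = e @ (u \<otimes>\<^bsub>side M (p \<longleftrightarrow> even (length e))\<^esub> x') # v' # w' # r \<and>
    local_red (side M (p \<longleftrightarrow> even (length e))) x x' v w v' w'"
proof (induction rule: inner_red.induct)
  case (here p x x' v w v' w' u r)
  then show ?case
    by - (rule exI[of _ "[]"], rule exI[of _ u], rule exI[of _ v], rule exI[of _ w],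
        rule exI[of _ r], rule exI[of _ x], rule exI[of _ x'], rule exI[of _ v'],
        rule exI[of _ w'], auto)
next
  case (there p a b c)
  have parity: "((\<not> p) \<longleftrightarrow> even (length e)) = (p \<longleftrightarrow> even (length (c # e)))" for e :: "'a list"
    by auto
  obtain e u v w r x x' v' w' where e: "e \<in> multifractions M" and *: "x \<noteq> \<one>\<^bsub>M\<^esub>"
    "a = e @ u # v # w # r"
    "b = e @ (u \<otimes>\<^bsub>side M (p \<longleftrightarrow> even (length (c # e)))\<^esub> x') # v' # w' # r"
    "local_red (side M (p \<longleftrightarrow> even (length (c # e)))) x x' v w v' w'"
    using there.IH unfolding parity by blast
  show ?case
    by (rule exI[of _ "c # e"], rule exI[of _ u], rule exI[of _ v], rule exI[of _ w],
        rule exI[of _ r], rule exI[of _ x], rule exI[of _ x'], rule exI[of _ v'],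
        rule exI[of _ w']) (use e * \<open>c \<in> carrier M\<close> in \<open>simp only: append_Cons lists.intros simp_thms\<close>)
qed

lemma list_split_three:
  assumes "i + 2 < length a"
  shows "a = take i a @ a ! i # a ! (i + 1) # a ! (i + 2) # drop (i + 3) a"
  using assms id_take_nth_drop[of i a] Cons_nth_drop_Suc[of "i + 1" a]
    Cons_nth_drop_Suc[of "i + 2" a]
  by (simp add: eval_nat_numeral)

lemma local_red_side:
  "local_red (side M p) x x' v w v' w' \<longleftrightarrow>
    (if p then local_red M x x' v w v' w' else local_red (opposite M) x x' v w v' w')"
  by (simp add: side_def local_red_def)

context gcd_monoid
begin

interpretation side: gcd_monoid "side M p" for p
  by (rule gcd_monoid_side)

lemma reduce_at_imp_red_step:
  assumes R: "reduce_at M i x a b" and x: "x \<noteq> \<one>"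
  shows "red_step M True a b"
proof -
  have ab: "x \<in> carrier M" "a \<in> multifractions M" "b \<in> multifractions M" "length b = length a"
      "i < length a" "1 \<le> i"
    and same: "\<forall>k\<in>{1..length a} - {i - 1, i, i + 1}. entry b k = entry a k"
    using R unfolding reduce_at_def by blast+
  \<comment> \<open>Entry \<open>i - 1\<close> has list index \<open>i - 2\<close>; for
    \<open>i = 1\<close> there is no such entry and \<open>i - 2\<close> truncates to 0, hence the
    disjunct.\<close>
  have same': "b ! j = a ! j" if "j < length a" "j \<noteq> i - 2 \<or> i = 1" "j \<noteq> i - 1" "j \<noteq> i" for j
  proof -
    have "Suc j \<noteq> i - 1" "Suc j \<noteq> i" "Suc j \<noteq> i + 1" using that ab by arith+
    then show ?thesis using bspec[OF same, of "Suc j"] that by simp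
  qed
  have mem: "a ! j \<in> carrier M" "b ! j \<in> carrier M" if "j < length a" for j
    using that ab by (metis in_listsD nth_mem)+
  show ?thesis
  proof (cases "i = 1")
    case True
    have a: "a = a ! 0 # a ! 1 # drop 2 a" "b = b ! 0 # b ! 1 # drop 2 b"
      using ab(4,5) True Cons_nth_drop_Suc[of 0 a, symmetric] Cons_nth_drop_Suc[of 1 a]
        Cons_nth_drop_Suc[of 0 b] Cons_nth_drop_Suc[of 1 b]
      by (cases a; cases b; simp add: eval_nat_numeral)+
    have "0 < length a" using ab(5) by linarith
    note mem0 = mem[OF this]
    have "drop 2 a = drop 2 b"
      using ab True same' by (intro nth_equalityI) auto
    moreover have "local_red (side M False) x \<one> (a ! 0) (a ! 1) (b ! 0) (b ! 1)"
      using side.local_red_divide[of x False "b ! 0" "b ! 1"] ab mem0 mem[of 1] True R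
      by (simp add: reduce_at_def mult_side)
    moreover have "drop 2 a \<in> multifractions M"
      using ab by (auto dest: in_set_dropD)
    ultimately show ?thesis
      using red_step.divide[of M True x "a ! 0" "a ! 1" "b ! 0" "b ! 1" "drop 2 a"] a x by simp
  next
    case False
    \<comment> \<open>The list index of entry \<open>i - 1\<close>, so also the length of the
      unchanged prefix; it has the parity of \<open>i\<close>.\<close>
    define n where "n = i - 2"
    have i: "i = n + 2" using False ab by (simp add: n_def)
    have a: "a = take n a @ a ! n # a ! (n + 1) # a ! (n + 2) # drop (n + 3) a"
      and b: "b = take n b @ b ! n # b ! (n + 1) # b ! (n + 2) # drop (n + 3) b"
      using ab i by (intro list_split_three; simp)+
    have td: "take n b = take n a" "drop (n + 3) b = drop (n + 3) a"
      using ab i same' by (auto intro!: nth_equalityI)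
    have parts: "take n a \<in> multifractions M" "drop (n + 3) a \<in> multifractions M"
      using ab by (auto dest: in_set_dropD in_set_takeD)
    have len: "length (take n a) = n" using ab i by simp
    obtain x' where "if even n
        then local_red M x x' (a ! (n + 1)) (a ! (n + 2)) (b ! (n + 1)) (b ! (n + 2))
        else local_red (opposite M) x x' (a ! (n + 1)) (a ! (n + 2)) (b ! (n + 1)) (b ! (n + 2))"
      and bn: "b ! n = a ! n \<otimes>\<^bsub>side M (even n)\<^esub> x'"
      using R ab mem i unfolding reduce_at_def local_red_def mult_side
      by (cases "even n") auto
    then have T: "local_red (side M (even n)) x x' (a ! (n + 1)) (a ! (n + 2))
        (b ! (n + 1)) (b ! (n + 2))"
      unfolding local_red_side by blast
    have "a ! n \<in> carrier M" using mem i ab by simp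
    then have "inner_red M (True \<longleftrightarrow> even (length (take n a)))
        (a ! n # a ! (n + 1) # a ! (n + 2) # drop (n + 3) a)
        (b ! n # b ! (n + 1) # b ! (n + 2) # drop (n + 3) a)"
      unfolding len bn simp_thms by (rule inner_red.here[OF T x _ parts(2)])
    from inner_red_append[OF this parts(1)] have "inner_red M True a b"
      unfolding a[symmetric] b[unfolded td, symmetric] .
    then show ?thesis by (rule red_step.inner)
  qed
qed

lemma red_step_imp_reduce_at:
  assumes "red_step M True a b"
  obtains i x where "reduce_at M i x a b" "x \<noteq> \<one>"
  using assms
proof cases
  case (divide x v w v' w' r)
  have "entry b k = entry a k" if "k \<in> {1..length a} - {0, 1, 2}" for k
  proof -
    have "k = (k - 3) + 3" using that by auto
    then obtain j where "k = j + 3" by blast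
    then show ?thesis using divide by simp
  qed
  then have "reduce_at M 1 x a b"
    using divide red_step_closed[OF assms] side.local_red_closed[OF divide(3)]
      side.local_red_right_one[of False x v w v' w']
    by (auto simp: reduce_at_def mult_side)
  then show ?thesis using that divide by blast
next
  case inner
  then obtain e u v w r x x' v' w' where x: "x \<noteq> \<one>" and a: "a = e @ u # v # w # r"
    and b: "b = e @ (u \<otimes>\<^bsub>side M (True \<longleftrightarrow> even (length e))\<^esub> x') # v' # w' # r"
    and T: "local_red (side M (True \<longleftrightarrow> even (length e))) x x' v w v' w'"
    using inner_red_decomp[OF inner] by (elim exE conjE) (rule that)
  define n where "n = length e"
  have ent: "a ! n = u" "a ! Suc n = v" "a ! Suc (Suc n) = w"
    "b ! n = u \<otimes>\<^bsub>side M (even n)\<^esub> x'" "b ! Suc n = v'" "b ! Suc (Suc n) = w'"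
    by (simp_all add: a b n_def nth_append)
  have "entry b k = entry a k" if "k \<in> {1..length a} - {n + 1, n + 2, n + 3}" for k
  proof (cases "k - 1 < n")
    case True
    then show ?thesis by (simp add: a b n_def nth_append)
  next
    case False
    define j where "j = k - (n + 4)"
    have "k - 1 = length e + (j + 3)" using that False by (auto simp: n_def j_def)
    then show ?thesis by (simp only: a b nth_append_length_plus) simp
  qed
  moreover have "if even n then local_red M x x' v w v' w' else local_red (opposite M) x x' v w v' w'"
    using T by (simp add: local_red_side n_def)
  ultimately have "reduce_at M (n + 2) x a b"
    using red_step_closed[OF assms] side.local_red_closed[OF T] ent
    unfolding reduce_at_def local_red_def mult_side
    by (auto simp: a b n_def split: if_splits)
  then show ?thesis using that x by blast
qed

lemma mf_step_iff:
  "mf_step M a b \<longleftrightarrow> red_step M True a b \<or> b \<in> multifractions M \<and> a = b @ [\<one>]"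
  by (metis mf_step.cases mf_step.reduce mf_step.trim red_step_imp_reduce_at
      reduce_at_imp_red_step)

lemma mf_step_closed: "mf_step M a b \<Longrightarrow> a \<in> multifractions M \<and> b \<in> multifractions M"
  using red_step_closed[of True a b] by (auto simp: mf_step_iff)

end

text \<open>The sign serves twice: as an exponent in the presentation, and in the termination order
  as a record of the side on which the entry can be divided.\<close>

fun signed_word :: "bool \<Rightarrow> 'a list \<Rightarrow> (bool \<times> 'a) list" where
  "signed_word p [] = []"
| "signed_word p (c # a) = (p, c) # signed_word (\<not> p) a"

lemma length_signed_word [simp]: "length (signed_word p a) = length a"
  by (induction p a rule: signed_word.induct) auto

lemma signed_word_append:
  "signed_word p (a @ b) = signed_word p a @ signed_word (p \<longleftrightarrow> even (length a)) b"
proof (induction p a rule: signed_word.induct)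
  case (2 p c a)
  then show ?case by (cases p) auto
qed simp

lemma signed_word_closed: "a \<in> multifractions M \<Longrightarrow> signed_word p a \<in> signed_words M"
  by (induction p a rule: signed_word.induct) auto

section \<open>Convergence\<close>

text \<open>
  The entry \<open>a\<^sub>i\<^sub>+\<^sub>1\<close> is replaced by a proper factor of it, on a side that depends only on the parity
  of \<open>i\<close>, and the entries after it are kept.
\<close>

definition factor_rel :: "('a, 'b) monoid_scheme \<Rightarrow> ((bool \<times> 'a) \<times> (bool \<times> 'a)) set" where
  "factor_rel M = same_fst (\<lambda>_. True)
     (\<lambda>q. {(w', w). w' \<in> carrier M \<and> w \<in> carrier M \<and> properfactor (side M (\<not> q)) w' w})"

lemma wf_factor_rel:
  assumes "noetherian M"
  shows "wf (factor_rel M)"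
proof -
  have *: "wf {(w', w). w' \<in> carrier M \<and> w \<in> carrier M \<and> properfactor (side M q) w' w}" for q
  proof (rule wf_subset)
    have "wfp_on (carrier M) (properfactor (side M q))"
      using noetherian_side[OF assms, of q] by (simp add: noetherian_def)
    then show "wf {(w', w). properfactor (side M q) w' w \<and> w' \<in> carrier M \<and> w \<in> carrier M}"
      by (rule wfp_on_iff_wfp[THEN iffD1, unfolded wfp_def])
  qed auto
  show ?thesis unfolding factor_rel_def by (rule wf_same_fst) (rule *)
qed

context gcd_monoid
begin

interpretation side: gcd_monoid "side M p" for p
  by (rule gcd_monoid_side)

lemma properfactor_mult:
  assumes "a \<in> carrier M" "x \<in> carrier M" "x \<noteq> \<one>"
  shows "properfactor M a (a \<otimes> x)"
proof (rule properfactorI)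
  show "\<not> (a \<otimes> x) divides a"
  proof
    assume "(a \<otimes> x) divides a"
    then obtain y where "y \<in> carrier M" "a = a \<otimes> x \<otimes> y" by (auto simp: factor_def)
    then have "x \<otimes> y = \<one>"
      using assms prod_eq_self_imp_one[of a "x \<otimes> y"] by (simp add: m_assoc)
    then show False using assms \<open>y \<in> carrier M\<close> prod_one_imp_one by blast
  qed
qed (use assms in auto)

lemma local_red_factor_rel:
  assumes T: "local_red (side M q) x x' v w v' w'" and x: "x \<noteq> \<one>"
  shows "((q, w'), (q, w)) \<in> factor_rel M"
proof -
  have "properfactor (side M (\<not> q)) w' (w' \<otimes>\<^bsub>side M (\<not> q)\<^esub> x)"
    by (rule gcd_monoid.properfactor_mult[OF gcd_monoid_side])
       (use side.local_red_closed[OF T] x in auto)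
  moreover have "w' \<otimes>\<^bsub>side M (\<not> q)\<^esub> x = w"
    using side.local_red_eqs(2)[OF T] by (cases q) (auto simp: mult_side)
  ultimately show ?thesis
    using side.local_red_closed[OF T] by (simp add: factor_rel_def same_fst_def)
qed

lemma inner_red_lex:
  "inner_red M p a b \<Longrightarrow>
    (rev (signed_word p b), rev (signed_word p a)) \<in> lex (factor_rel M)"
proof (induction rule: inner_red.induct)
  case (here p x x' v w v' w' u r)
  then show ?case
    using local_red_factor_rel[OF here(1,2)] by (auto intro!: lex_append_leftI)
next
  case (there p a b c)
  then show ?case by (auto intro!: lex_append_rightI)
qed

lemma red_step_lex:
  "red_step M p a b \<Longrightarrow>
    (rev (signed_word p b), rev (signed_word p a)) \<in> lex (factor_rel M)"
proof (induction rule: red_step.induct)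
  case (divide p x v w v' w' r)
  then show ?case
    using local_red_factor_rel[OF divide(1,2)] by (auto intro!: lex_append_leftI)
qed (rule inner_red_lex)

text \<open>Trimming shortens the list and all other steps keep its length, so comparing lengths
  before entries, as \<open>lenlex\<close> does, covers both. The words are reversed because the
  rightmost change decides.\<close>

lemma wfp_mf_step:
  assumes "noetherian M"
  shows "wfp (mf_step M)\<inverse>\<inverse>"
proof -
  have "wf (inv_image (lenlex (factor_rel M)) (\<lambda>a. rev (signed_word True a)))"
    using wf_factor_rel[OF assms] by (intro wf_inv_image wf_lenlex)
  moreover have "{(b, a). (mf_step M)\<inverse>\<inverse> b a}
      \<subseteq> inv_image (lenlex (factor_rel M)) (\<lambda>a. rev (signed_word True a))"
    using red_step_lex by (fastforce simp: mf_step_iff lenlex_conv lex_conv)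
  ultimately show ?thesis unfolding wfp_def by (rule wf_subset)
qed

lemma joinable_mf_step:
  assumes ore: "three_ore M" and b: "mf_step M a b" and c: "mf_step M a c"
  shows "joinable (mf_step M) b c"
proof -
  have le: "(red_step M True)\<^sup>*\<^sup>* \<le> (mf_step M)\<^sup>*\<^sup>*"
    by (rule rtranclp_mono) (auto simp: mf_step_iff)
  have trim: "joinable (mf_step M) b c"
    if b: "b \<in> multifractions M" and c: "red_step M True (b @ [\<one>]) c" for b c
  proof -
    obtain d where "c = d @ [\<one>]" "red_step M True b d"
      using red_step_snoc_one[OF c] by blast
    then have "mf_step M b d" "mf_step M c d"
      using red_step_closed mf_step_iff by blast+
    then show ?thesis unfolding joinable_def by blast
  qed
  consider "red_step M True a b" "red_step M True a c"
    | "red_step M True a b" "c \<in> multifractions M" "a = c @ [\<one>]"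
    | "red_step M True a c" "b \<in> multifractions M" "a = b @ [\<one>]"
    | "b = c"
    using b c by (auto simp: mf_step_iff)
  then show ?thesis
  proof cases
    case 1
    then show ?thesis
      using joinable_red_step[OF ore 1] le unfolding joinable_def by blast
  next
    case 2
    then show ?thesis using trim joinable_sym by metis
  next
    case 3
    then show ?thesis using trim by metis
  next
    case 4
    then show ?thesis by (auto simp: joinable_def)
  qed
qed

end

lemma newman:
  assumes wf: "wfp R\<inverse>\<inverse>" and local: "\<And>a b c. R a b \<Longrightarrow> R a c \<Longrightarrow> joinable R b c"
  shows "confluentp R"
proof (rule confluentpI)
  fix a b c
  show "R\<^sup>*\<^sup>* a b \<Longrightarrow> R\<^sup>*\<^sup>* a c \<Longrightarrow> \<exists>d. R\<^sup>*\<^sup>* b d \<and> R\<^sup>*\<^sup>* c d"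
  proof (induction a arbitrary: b c rule: wfp_induct_rule[OF wf])
    case (1 a)
    show ?case
    proof (cases "a = b \<or> a = c")
      case True
      then show ?thesis using 1 by blast
    next
      case False
      then obtain b' c' where b': "R a b'" "R\<^sup>*\<^sup>* b' b" and c': "R a c'" "R\<^sup>*\<^sup>* c' c"
        using 1 by (metis converse_rtranclpE)
      then obtain d where d: "R\<^sup>*\<^sup>* b' d" "R\<^sup>*\<^sup>* c' d"
        using local unfolding joinable_def by blast
      obtain e where e: "R\<^sup>*\<^sup>* b e" "R\<^sup>*\<^sup>* d e"
        using 1(1)[of b' b d] b' d by auto
      then obtain f where "R\<^sup>*\<^sup>* e f" "R\<^sup>*\<^sup>* c f"
        using 1(1)[of c' e c] c' d by (meson conversep.intros rtranclp_trans)
      then show ?thesis using e by (meson rtranclp_trans)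
    qed
  qed
qed

section \<open>The enveloping group\<close>

text \<open>Inversion reverses products, so a homomorphism from \<open>M\<close> followed by
  \<open>signed H p\<close> is multiplicative on \<open>side M p\<close>; one computation then
  covers both parities.\<close>

definition signed :: "('g, 'h) monoid_scheme \<Rightarrow> bool \<Rightarrow> 'g \<Rightarrow> 'g" where
  "signed H p g = (if p then g else inv\<^bsub>H\<^esub> g)"

text \<open>From \<open>x \<otimes> v' = v \<otimes> x'\<close> the quotient
  \<open>inv v \<otimes> x\<close> equals \<open>x' \<otimes> inv v'\<close>: the cofactor
  \<open>x'\<close> gained on the left compensates for the \<open>x\<close> split off from
  \<open>w\<close>.\<close>

lemma (in group) local_exchange:
  assumes "{x, x', v, v', w, w', k} \<subseteq> carrier G"
    and "x \<otimes> v' = v \<otimes> x'" "x \<otimes> w' = w"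
  shows "inv v \<otimes> (w \<otimes> k) = x' \<otimes> (inv v' \<otimes> (w' \<otimes> k))"
proof -
  have "inv v \<otimes> x = x' \<otimes> inv v'"
    using assms by (metis insert_subset inv_closed inv_solve_left inv_solve_right m_assoc m_closed)
  then have "inv v \<otimes> x \<otimes> (w' \<otimes> k) = x' \<otimes> inv v' \<otimes> (w' \<otimes> k)"
    by (rule arg_cong)
  moreover have "w \<otimes> k = x \<otimes> (w' \<otimes> k)"
    using assms by (metis insert_subset m_assoc)
  ultimately show ?thesis
    using assms(1) by (simp add: m_assoc)
qed

context gcd_monoid
begin

interpretation side: gcd_monoid "side M p" for p
  by (rule gcd_monoid_side)

lemma alternating_prod_inner_red:
  assumes H: "group H" and f: "f \<in> hom M H"
  shows "inner_red M p a b \<Longrightarrow>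
    alternating_prod H p (map f a) = alternating_prod H p (map f b)"
proof (induction rule: inner_red.induct)
  interpret H: group H by fact
  have fc: "f a \<in> carrier H" if "a \<in> carrier M" for a
    using f that by (auto simp: hom_def)
  have ac: "alternating_prod H p (map f a) \<in> carrier H" if "a \<in> multifractions M" for p a
    using that by (induction a arbitrary: p) (auto simp: fc)
  {
    case (here p x x' v w v' w' u r)
    define h where "h a = signed H p (f a)" for a
    have hc: "h a \<in> carrier H" if "a \<in> carrier M" for a
      using fc that by (simp add: h_def signed_def)
    have h_mult: "h (a \<otimes>\<^bsub>side M p\<^esub> b) = h a \<otimes>\<^bsub>H\<^esub> h b" if "a \<in> carrier M" "b \<in> carrier M" for a b
      using that f fc by (auto simp: h_def signed_def mult_side hom_mult H.inv_mult_group)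
    note c = side.local_red_closed[OF here(1), simplified] here(3)
    note eq = side.local_red_eqs[OF here(1)]
    define k where "k = alternating_prod H (\<not> p) (map f r)"
    have kc: "k \<in> carrier H" using ac here(4) by (simp add: k_def)
    have ap: "alternating_prod H p (map f (a # b # d # r))
        = h a \<otimes>\<^bsub>H\<^esub> (inv\<^bsub>H\<^esub> (h b) \<otimes>\<^bsub>H\<^esub> (h d \<otimes>\<^bsub>H\<^esub> k))" if "b \<in> carrier M" for a b d
      using that fc by (simp add: h_def signed_def k_def)
    have "inv\<^bsub>H\<^esub> (h v) \<otimes>\<^bsub>H\<^esub> (h w \<otimes>\<^bsub>H\<^esub> k)
        = h x' \<otimes>\<^bsub>H\<^esub> (inv\<^bsub>H\<^esub> (h v') \<otimes>\<^bsub>H\<^esub> (h w' \<otimes>\<^bsub>H\<^esub> k))"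
      using c hc kc eq by (intro H.local_exchange[of "h x"]) (auto simp flip: h_mult)
    then show ?case
      using c hc kc by (simp only: ap h_mult) (simp add: H.m_assoc)
  next
    case (there p a b c)
    then show ?case by simp
  }
qed

lemma alternating_prod_red_step:
  assumes H: "group H" and f: "f \<in> hom M H" and R: "red_step M p a b"
  shows "alternating_prod H p (map f a) = alternating_prod H p (map f b)"
proof -
  interpret H: group H by fact
  have fc: "f a \<in> carrier H" if "a \<in> carrier M" for a
    using f that by (auto simp: hom_def)
  have ac: "alternating_prod H p (map f a) \<in> carrier H" if "a \<in> multifractions M" for p a
    using that by (induction a arbitrary: p) (auto simp: fc)
  \<comment> \<open>Prefixing \<open>\<one>\<close> turns a division at the head into an inner rule,
    for which invariance is known; the extra factor is then cancelled in the group.\<close>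
  have "inner_red M (\<not> p) (\<one> # a) (\<one> # b)"
    using R by (intro red_step_Cons) auto
  then have "alternating_prod H (\<not> p) (map f (\<one> # a)) = alternating_prod H (\<not> p) (map f (\<one> # b))"
    by (rule alternating_prod_inner_red[OF H f])
  then show ?thesis
    using ac red_step_closed[OF R] fc by (cases p) auto
qed

section \<open>Multifractions as words of the presentation\<close>

lemma represented_eq_class:
  "a \<in> multifractions M \<Longrightarrow> represented M a = env_rel M `` {signed_word True a}"
proof -
  interpret U: group "env_group M" by (rule group_env_group)
  have "alternating_prod (env_group M) p (map (env_emb M) a) = env_rel M `` {signed_word p a}"
    if "a \<in> multifractions M" for p
    using that
  proof (induction a arbitrary: p)
    case Nil
    then show ?case by (simp add: env_one_class)
  next
    case (Cons c a)
    have c: "c \<in> carrier M" using Cons by simp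
    have "env_rel M `` {[(False, c)]} \<otimes>\<^bsub>env_group M\<^esub> env_rel M `` {[(True, c)]}
        = \<one>\<^bsub>env_group M\<^esub>"
      using c by (simp add: env_mult_class env_one_class env_class_eq_iff env_l_inv)
    then have "inv\<^bsub>env_group M\<^esub> env_emb M c = env_rel M `` {[(False, c)]}"
      using c by (simp add: env_emb_def U.inv_equality env_class_closed)
    then show ?case
      using Cons c by (auto simp: env_emb_def env_mult_class signed_word_closed)
  qed
  then show "a \<in> multifractions M \<Longrightarrow> represented M a = env_rel M `` {signed_word True a}"
    by (simp add: represented_def)
qed

lemma represented_eq_iff:
  "a \<in> multifractions M \<Longrightarrow> b \<in> multifractions M \<Longrightarrow>
    represented M a = represented M b \<longleftrightarrow> env_eq M (signed_word True a) (signed_word True b)"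
  by (simp add: represented_eq_class env_class_eq_iff signed_word_closed)

lemma env_eq_append_left:
  "env_eq M v v' \<Longrightarrow> u \<in> signed_words M \<Longrightarrow> env_eq M (u @ v) (u @ v')"
  by (rule env_append) (rule env_refl)

lemma env_eq_append_right:
  "env_eq M u u' \<Longrightarrow> v \<in> signed_words M \<Longrightarrow> env_eq M (u @ v) (u' @ v)"
  by (rule env_append) (auto intro: env_refl)

lemma env_eq_one_Cons: "u \<in> signed_words M \<Longrightarrow> env_eq M ((True, \<one>) # u) u"
  using env_eq_append_right[OF env_one] by simp

lemma env_eq_mult_Cons:
  "a \<in> carrier M \<Longrightarrow> b \<in> carrier M \<Longrightarrow> u \<in> signed_words M \<Longrightarrow>
    env_eq M ((True, a \<otimes> b) # u) ((True, a) # (True, b) # u)"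
  using env_eq_append_right[OF env_sym[OF env_mult]] by simp

lemma represented_mf_step:
  assumes "mf_step M a b"
  shows "represented M a = represented M b"
  using assms unfolding mf_step_iff
proof
  assume "red_step M True a b"
  then show ?thesis
    unfolding represented_def
    by (rule alternating_prod_red_step[OF group_env_group env_emb_hom])
next
  assume b: "b \<in> multifractions M \<and> a = b @ [\<one>]"
  have "env_eq M [(p, \<one>)] []" for p
  proof (cases p)
    case False
    have "env_eq M ([(False, \<one>)] @ []) ([(False, \<one>)] @ [(True, \<one>)])"
      by (rule env_eq_append_left[OF env_sym[OF env_one]]) simp
    moreover have "env_eq M ([(False, \<one>)] @ [(True, \<one>)]) []"
      using env_l_inv[of \<one> M] by simp
    ultimately show ?thesis using False by (auto intro: env_trans)
  qed (simp add: env_one)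
  then have "env_eq M (signed_word True b @ [(even (length b), \<one>)]) (signed_word True b @ [])"
    using b by (intro env_eq_append_left signed_word_closed) auto
  then show ?thesis
    using b represented_eq_iff[of a b] by (simp add: signed_word_append)
qed

lemma represented_mf_reduces: "mf_reduces M a b \<Longrightarrow> represented M a = represented M b"
  by (induction rule: rtranclp_induct) (auto dest: represented_mf_step)

lemma mf_reduces_closed:
  "mf_reduces M a b \<Longrightarrow> a \<in> multifractions M \<Longrightarrow> b \<in> multifractions M"
  by (induction rule: rtranclp_induct) (use mf_step_closed in blast)+

lemma represented_mf_mult:
  assumes a: "a \<in> multifractions M" and b: "b \<in> multifractions M"
  shows "mf_mult M a b \<in> multifractions M"
    and "represented M (mf_mult M a b) = represented M a \<otimes>\<^bsub>env_group M\<^esub> represented M b"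
proof -
  have "mf_mult M a b \<in> multifractions M \<and>
    env_eq M (signed_word True (mf_mult M a b)) (signed_word True a @ signed_word True b)"
  proof (cases "a = [] \<or> b = [] \<or> even (length a)")
    case True
    then show ?thesis
      using a b by (auto simp: mf_mult_def signed_word_append intro!: env_refl signed_word_closed)
  next
    \<comment> \<open>At odd depth the junction brings together two positive letters, which a single
      relation of the presentation merges.\<close>
    case False
    then obtain a' l k b' where ab: "a = a' @ [l]" "b = k # b'" "even (length a')"
      by (cases a rule: rev_cases; cases b) auto
    then have "mf_mult M a b = a' @ (l \<otimes> k) # b'"
      by (simp add: mf_mult_def)
    moreover have "env_eq M (signed_word True a' @ (True, l \<otimes> k) # signed_word False b')
        (signed_word True a' @ (True, l) # (True, k) # signed_word False b')"
      using a b ab by (intro env_eq_append_left env_eq_mult_Cons signed_word_closed) auto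
    ultimately show ?thesis
      using a b ab by (simp add: signed_word_append)
  qed
  then show "mf_mult M a b \<in> multifractions M"
    "represented M (mf_mult M a b) = represented M a \<otimes>\<^bsub>env_group M\<^esub> represented M b"
    using a b
    by (simp_all add: represented_eq_class env_mult_class env_class_eq_iff signed_word_closed)
qed

end

section \<open>Action of signed words on multifractions\<close>

text \<open>
  The letters of the presentation act on multifractions on the left; modulo reductions, the
  action factors through the enveloping group.
\<close>

fun act :: "('a, 'b) monoid_scheme \<Rightarrow> bool \<times> 'a \<Rightarrow> 'a list \<Rightarrow> 'a list" where
  "act M (True, a) [] = [a]"
| "act M (True, a) (d # c) = (a \<otimes>\<^bsub>M\<^esub> d) # c"
| "act M (False, a) c = \<one>\<^bsub>M\<^esub> # a # c"

context gcd_monoid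
begin

interpretation side: gcd_monoid "side M p" for p
  by (rule gcd_monoid_side)

lemma act_closed:
  "a \<in> carrier M \<Longrightarrow> c \<in> multifractions M \<Longrightarrow> act M (s, a) c \<in> multifractions M"
  by (cases s; cases c) auto

lemma acts_closed:
  "u \<in> signed_words M \<Longrightarrow> c \<in> multifractions M \<Longrightarrow> foldr (act M) u c \<in> multifractions M"
proof (induction u)
  case (Cons l u)
  then show ?case using act_closed[of "snd l" "foldr (act M) u c" "fst l"] by simp
qed simp

text \<open>A positive letter multiplies the first entry on the left, whereas the rules multiply or
  divide that entry on the right. A negative letter shifts all positions by two, which preserves
  parities.\<close>

lemma red_step_act:
  assumes R: "red_step M True c d" and a: "a \<in> carrier M"
  shows "red_step M True (act M (s, a) c) (act M (s, a) d)"
proof (cases s)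
  case False
  have "inner_red M False (a # c) (a # d)"
    using R a by (intro red_step_Cons) auto
  then show ?thesis
    using False inner_red.there[of M True "a # c" "a # d" \<one>] by (auto intro: red_step.inner)
next
  case True
  from R show ?thesis
  proof cases
    case (divide x v w v' w' r)
    note c = side.local_red_closed[OF divide(3), simplified]
    have "v = v' \<otimes> x" "w = w' \<otimes> x"
      using side.local_red_right_one[of False x v w v' w'] divide(3) by (simp_all add: mult_side)
    then have "local_red (side M (\<not> True)) x \<one> (a \<otimes> v) w (a \<otimes> v') w'"
      using side.local_red_divide[of x False "a \<otimes> v'" w'] a c by (simp add: mult_side m_assoc)
    then show ?thesis using True divide red_step.divide by fastforce
  next
    case inner
    then show ?thesis
    proof cases
      case (here x x' v w v' w' u r)
      note c = side.local_red_closed[OF here(3), simplified]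
      have "inner_red M True ((a \<otimes> u) # v # w # r) (((a \<otimes> u) \<otimes>\<^bsub>side M True\<^esub> x') # v' # w' # r)"
        using here a by (intro inner_red.here) auto
      then show ?thesis
        using True here a c by (auto simp: mult_side m_assoc intro: red_step.inner)
    next
      case (there c' d' k)
      then show ?thesis
        using True a by (auto intro!: red_step.inner inner_red.there)
    qed
  qed
qed

lemma equivclp_act:
  assumes "equivclp (mf_step M) c d" and a: "a \<in> carrier M"
  shows "equivclp (mf_step M) (act M (s, a) c) (act M (s, a) d)"
proof -
  have step: "equivclp (mf_step M) (act M (s, a) c) (act M (s, a) d)" if "mf_step M c d" for c d
  proof (cases "red_step M True c d")
    case True
    then have "mf_step M (act M (s, a) c) (act M (s, a) d)"
      using red_step_act a by (simp add: mf_step_iff)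
    then show ?thesis by blast
  next
    case False
    then have d: "d \<in> multifractions M" "c = d @ [\<one>]"
      using that by (auto simp: mf_step_iff)
    \<comment> \<open>The two lists coincide when a positive letter acts with \<open>d = []\<close>:
      it absorbs the final \<open>\<one>\<close> of \<open>c\<close>.\<close>
    then have "act M (s, a) c = act M (s, a) d \<or> act M (s, a) c = act M (s, a) d @ [\<one>]"
      using a by (cases s; cases d) auto
    then show ?thesis
      using mf_step.trim[OF act_closed[OF a d(1), of s]] by auto
  qed
  show ?thesis
    using assms(1)
    by (induction rule: equivclp_induct) (auto intro: equivclp_trans dest: step equivclp_sym[OF step])
qed

text \<open>The lcm of \<open>\<one>\<close> and \<open>d\<close> is \<open>d\<close>, so the rule
  by \<open>d\<close> turns \<open>1/1/d\<close> into \<open>d/1/1\<close>. The trivial pair travels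
  in this way to the right end, where it can be trimmed.\<close>

lemma red_steps_one_one:
  "c \<in> multifractions M \<Longrightarrow> (red_step M p)\<^sup>*\<^sup>* (\<one> # \<one> # c) (c @ [\<one>, \<one>])"
proof (induction c arbitrary: p)
  case (Cons d c)
  then have d: "d \<in> carrier M" "c \<in> multifractions M" by auto
  have "local_red (side M p) d d \<one> d \<one> \<one>"
    using d by (intro side.local_redI) (auto simp: mult_side factor_def)
  then have "(red_step M p)\<^sup>*\<^sup>* (\<one> # \<one> # d # c) ((\<one> \<otimes>\<^bsub>side M p\<^esub> d) # \<one> # \<one> # c)"
    using d by (intro red_steps_here) auto
  moreover have "\<one> \<otimes>\<^bsub>side M p\<^esub> d = d"
    using d side.l_one[of d p] by simp
  moreover have "(red_step M p)\<^sup>*\<^sup>* (d # \<one> # \<one> # c) (d # c @ [\<one>, \<one>])"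
    using Cons.IH[OF d(2)] d by (intro red_steps_Cons) auto
  ultimately show ?case by simp
qed simp

lemma red_steps_imp_mf_reduces: "(red_step M True)\<^sup>*\<^sup>* a b \<Longrightarrow> mf_reduces M a b"
  by (rule rtranclp_mono[THEN predicate2D]) (auto simp: mf_step_iff)

lemma mf_reduces_one_one:
  assumes "c \<in> multifractions M"
  shows "mf_reduces M (\<one> # \<one> # c) c"
proof -
  have "mf_step M (c @ [\<one>, \<one>]) (c @ [\<one>])" "mf_step M (c @ [\<one>]) c"
    using mf_step.trim[of "c @ [\<one>]" M] mf_step.trim[of c M] assms by simp_all
  then show ?thesis
    using red_steps_imp_mf_reduces[OF red_steps_one_one[OF assms]] by (meson rtranclp.simps)
qed

lemma equivclp_acts:
  "equivclp (mf_step M) c d \<Longrightarrow> u \<in> signed_words M \<Longrightarrow>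
    equivclp (mf_step M) (foldr (act M) u c) (foldr (act M) u d)"
  by (induction u) (auto intro: equivclp_act)

text \<open>Apart from trimming, only the two inverse relations need reductions:
  \<open>a/a/c\<close> becomes \<open>1/1/c\<close> by a division, \<open>1/a/ad/r\<close> becomes
  \<open>1/1/d/r\<close> by \<open>R(2,a)\<close>, and a leading \<open>1/1\<close>
  disappears.\<close>

lemma env_eq_acts:
  "env_eq M u v \<Longrightarrow> c \<in> multifractions M \<Longrightarrow>
    equivclp (mf_step M) (foldr (act M) u c) (foldr (act M) v c)"
proof (induction arbitrary: c rule: env_eq.induct)
  case (env_sym u v)
  then show ?case by (blast intro: equivclp_sym)
next
  case (env_trans u v w)
  then show ?case by (blast intro: equivclp_trans)
next
  case (env_append u u' v v')
  have "equivclp (mf_step M) (foldr (act M) u (foldr (act M) v c))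
      (foldr (act M) u (foldr (act M) v' c))"
    using equivclp_acts[OF env_append.IH(2)[OF env_append.prems]]
      env_eq_words(1)[OF env_append.hyps(1)] by blast
  moreover have "equivclp (mf_step M) (foldr (act M) u (foldr (act M) v' c))
      (foldr (act M) u' (foldr (act M) v' c))"
    using env_append.IH(1) acts_closed[OF env_eq_words(2)[OF env_append.hyps(2)] env_append.prems]
    by blast
  ultimately show ?case by (simp add: equivclp_trans)
next
  case env_one
  show ?case
  proof (cases c)
    case Nil
    then show ?thesis using mf_step.trim[of "[]" M] by auto
  qed (use env_one in auto)
next
  case (env_mult a b)
  then show ?case by (cases c) (auto simp: m_assoc)
next
  case (env_r_inv a)
  have "(red_step M True)\<^sup>*\<^sup>* (a # a # c) (\<one> # \<one> # c)"
    using side.local_red_divide[of a False \<one> \<one>] env_r_inv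
    by (intro red_steps_divide) (auto simp: mult_side)
  then have "mf_reduces M (a # a # c) c"
    using red_steps_imp_mf_reduces mf_reduces_one_one[OF env_r_inv(2)] by (meson rtranclp_trans)
  then show ?case using env_r_inv by (simp add: rtranclp_into_equivclp)
next
  case (env_l_inv a)
  \<comment> \<open>If \<open>c\<close> is empty, the letter creates the entry \<open>a\<close>,
    read as \<open>a \<otimes> d\<close> with \<open>d = \<one>\<close>; the list
    \<open>[\<one>]\<close> is afterwards trimmed to \<open>c\<close>.\<close>
  obtain d r where dr: "act M (True, a) c = (a \<otimes> d) # r" "d \<in> carrier M" "r \<in> multifractions M"
    "mf_reduces M (d # r) c"
  proof (cases c)
    case Nil
    then have "mf_reduces M [\<one>] c" using mf_step.trim[of "[]" M] by auto
    then show ?thesis using Nil that[of \<one> "[]"] env_l_inv by simp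
  qed (use env_l_inv that in auto)
  have "local_red (side M True) a \<one> a (a \<otimes> d) \<one> d"
    using side.local_red_divide[of a True \<one> d] env_l_inv dr by (simp add: mult_side)
  then have "(red_step M True)\<^sup>*\<^sup>* (\<one> # a # (a \<otimes> d) # r) ((\<one> \<otimes>\<^bsub>side M True\<^esub> \<one>) # \<one> # d # r)"
    using dr by (intro red_steps_here) auto
  then have "mf_reduces M (\<one> # a # (a \<otimes> d) # r) (\<one> # \<one> # d # r)"
    using red_steps_imp_mf_reduces by (simp add: mult_side)
  then have "mf_reduces M (\<one> # a # (a \<otimes> d) # r) c"
    using mf_reduces_one_one[of "d # r"] dr by (auto intro: rtranclp_trans)
  then show ?case using dr by (simp add: rtranclp_into_equivclp)
qed simp

lemma acts_signed_word:
  "a \<in> multifractions M \<Longrightarrow> foldr (act M) (signed_word True a) [] = a"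
proof (induction a rule: induct_list012)
  case (3 a b c)
  then show ?case by simp
qed auto

lemma represented_eq_iff_equivclp:
  assumes a: "a \<in> multifractions M" and b: "b \<in> multifractions M"
  shows "represented M a = represented M b \<longleftrightarrow> equivclp (mf_step M) a b"
proof
  assume "represented M a = represented M b"
  then show "equivclp (mf_step M) a b"
    using env_eq_acts[of "signed_word True a" "signed_word True b" "[]"] a b
    by (simp add: represented_eq_iff acts_signed_word)
next
  assume "equivclp (mf_step M) a b"
  then show "represented M a = represented M b"
    by (induction rule: equivclp_induct) (auto dest: represented_mf_step)
qed

section \<open>Representing every group element\<close>

lemma env_eq_signed_word_act:
  assumes a: "a \<in> carrier M" and c: "c \<in> multifractions M"
  shows "env_eq M (signed_word True (act M (s, a) c)) ((s, a) # signed_word True c)"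
proof (cases s)
  case True
  then show ?thesis
    using a c by (cases c) (auto intro!: env_refl env_eq_mult_Cons signed_word_closed)
next
  case False
  then show ?thesis
    using a c signed_word_closed[OF c, of True] by (auto intro!: env_eq_one_Cons)
qed

text \<open>The action puts an arbitrary word into alternating form: a positive letter is merged
  into the first entry, if there is one, and a negative letter gets a \<open>\<one>\<close> in
  front. Hence every class contains the word of a multifraction.\<close>

lemma env_eq_signed_word_acts:
  "u \<in> signed_words M \<Longrightarrow> env_eq M (signed_word True (foldr (act M) u [])) u"
proof (induction u)
  case Nil
  then show ?case by (auto intro: env_refl)
next
  case (Cons l u)
  obtain s a where l: "l = (s, a)" by (cases l)
  have u: "u \<in> signed_words M" and a: "a \<in> carrier M" using Cons.prems l by auto
  have "env_eq M (signed_word True (foldr (act M) (l # u) []))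
      ((s, a) # signed_word True (foldr (act M) u []))"
    using env_eq_signed_word_act[OF a acts_closed[OF u]] l by simp
  moreover have "env_eq M ([l] @ signed_word True (foldr (act M) u [])) ([l] @ u)"
    using Cons.IH u a l by (intro env_eq_append_left) auto
  ultimately show ?case using l by (auto intro: env_trans)
qed

lemma represented_surj:
  assumes "g \<in> carrier (env_group M)"
  obtains a where "a \<in> multifractions M" "represented M a = g"
proof -
  obtain u where u: "u \<in> signed_words M" "g = env_rel M `` {u}"
    using env_carrierE assms by metis
  define a where "a = foldr (act M) u []"
  have a: "a \<in> multifractions M" using acts_closed[OF u(1)] by (simp add: a_def)
  have "represented M a = g"
    using env_eq_signed_word_acts[OF u(1)] a u
    by (simp add: represented_eq_class env_class_eq_iff signed_word_closed a_def)
  then show ?thesis using that a by blast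
qed

lemma mf_reduces_Nil: "mf_reduces M [] b \<Longrightarrow> b = []"
  by (erule converse_rtranclpE)
     (auto simp: mf_step_iff elim: red_step.cases inner_red.cases)

text \<open>Gives the embedding of \<open>M\<close>: only trimming applies at depth one, so
  \<open>[a]\<close> and \<open>[b]\<close> have a common reduct only if
  \<open>a = b\<close>.\<close>

lemma mf_reduces_singleton:
  assumes "mf_reduces M [a] b"
  shows "b = [a] \<or> a = \<one> \<and> b = []"
  using assms
proof (cases rule: converse_rtranclpE)
  case (step c)
  have "\<not> red_step M True [a] c"
    by (auto elim!: red_step.cases elim: inner_red.cases)
  then have "c = []" "a = \<one>" using step(1) by (auto simp: mf_step_iff)
  then show ?thesis using step mf_reduces_Nil by auto
qed simp

end

section \<open>Existence of normal forms and consequences of confluence\<close>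

lemma wfp_conversep_normal_form:
  assumes "wfp R\<inverse>\<inverse>"
  obtains b where "R\<^sup>*\<^sup>* a b" "\<nexists>c. R b c"
proof -
  have "\<exists>b. R\<^sup>*\<^sup>* a b \<and> (\<nexists>c. R b c)"
  proof (induction a rule: wfp_induct_rule[OF assms])
    case (1 a)
    then show ?case by (metis conversep.intros converse_rtranclp_into_rtranclp rtranclp.rtrancl_refl)
  qed
  then show ?thesis using that by blast
qed

theorem theorem5p5:
  fixes M :: "('a, 'b) monoid_scheme"
  assumes "gcd_monoid M" and "noetherian M" and "three_ore M"
  shows
    "(\<forall>g\<in>carrier (env_group M). \<exists>!a. mf_irreducible M a \<and> represented M a = g) \<and>
     env_emb M \<in> mon M (env_group M) \<and>
     (\<forall>a\<in>multifractions M. \<exists>!b. mf_reduces M a b \<and> mf_irreducible M b) \<and>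
     (\<forall>a\<in>multifractions M. \<forall>b\<in>multifractions M.
        represented M a = represented M b \<longleftrightarrow> red M a = red M b) \<and>
     (\<forall>a\<in>multifractions M.
        represented M a = \<one>\<^bsub>env_group M\<^esub> \<longleftrightarrow> mf_reduces M a []) \<and>
     (\<forall>a\<in>multifractions M. \<forall>b\<in>multifractions M.
        represented M a \<otimes>\<^bsub>env_group M\<^esub> represented M b = represented M (red M (mf_mult M a b)))"
proof -
  interpret gcd_monoid M by fact
  interpret U: group "env_group M" by (rule group_env_group)
  have confl: "confluentp (mf_step M)"
    using newman[OF wfp_mf_step[OF assms(2)] joinable_mf_step[OF assms(3)]] .
  \<comment> \<open>The Church-Rosser property: by confluence, equivalent multifractions have a
    common reduct.\<close>
  have equivclp: "equivclp (mf_step M) a b \<longleftrightarrow> (\<exists>d. mf_reduces M a d \<and> mf_reduces M b d)" for a b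
    using semiconfluentp_equivclp[OF confluentp_imp_semiconfluentp[OF confl]]
    by (auto simp: rtranclp_conversep OO_def)
  have irr: "b = c" if "mf_reduces M b c" "mf_irreducible M b" for b c
    using that by (auto simp: mf_irreducible_def elim: converse_rtranclpE)
  have unique: "\<exists>!b. mf_reduces M a b \<and> mf_irreducible M b" if a: "a \<in> multifractions M" for a
  proof -
    obtain b where "mf_reduces M a b" "\<nexists>c. mf_step M b c"
      by (rule wfp_conversep_normal_form[OF wfp_mf_step[OF assms(2)]])
    then have "mf_reduces M a b \<and> mf_irreducible M b"
      using a mf_reduces_closed by (auto simp: mf_irreducible_def)
    moreover have "c = b" if "mf_reduces M a c \<and> mf_irreducible M c" for c
      using calculation that confluentpD[OF confl] irr by metis
    ultimately show ?thesis by blast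
  qed
  have red: "mf_reduces M a (red M a)" "mf_irreducible M (red M a)" if "a \<in> multifractions M" for a
    using theI'[OF unique[OF that]] by (simp_all add: red_def)
  have red_eq: "red M a = b" if "a \<in> multifractions M" "mf_reduces M a b" "mf_irreducible M b" for a b
    using unique[OF that(1)] red[OF that(1)] that by blast
  have rep_red: "represented M (red M a) = represented M a" if "a \<in> multifractions M" for a
    using represented_mf_reduces[OF red(1)[OF that]] by simp
  have rep_iff: "represented M a = represented M b \<longleftrightarrow> red M a = red M b"
    if ab: "a \<in> multifractions M" "b \<in> multifractions M" for a b
  proof
    assume "represented M a = represented M b"
    then obtain d where d: "mf_reduces M a d" "mf_reduces M b d"
      using represented_eq_iff_equivclp[OF ab] equivclp[of a b] by auto
    then have "d \<in> multifractions M" using that mf_reduces_closed by blast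
    then have "mf_reduces M a (red M d)" "mf_reduces M b (red M d)" "mf_irreducible M (red M d)"
      using d red by (auto intro: rtranclp_trans)
    then show "red M a = red M b"
      using red_eq ab by simp
  qed (metis rep_red that)
  have Nil: "mf_irreducible M []"
    by (auto simp: mf_irreducible_def mf_step_iff elim: red_step.cases inner_red.cases)
  have "\<exists>!a. mf_irreducible M a \<and> represented M a = g" if g: "g \<in> carrier (env_group M)" for g
  proof -
    obtain a where a: "a \<in> multifractions M" "represented M a = g"
      using represented_surj[OF g] by blast
    have "b = red M a" if "mf_irreducible M b" "represented M b = g" for b
      using that a rep_iff[of a b] red_eq[of b b] by (auto simp: mf_irreducible_def)
    then show ?thesis using red(2) rep_red a by metis
  qed
  moreover have "env_emb M \<in> mon M (env_group M)"
  proof -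
    have "a = b" if "a \<in> carrier M" "b \<in> carrier M" "env_emb M a = env_emb M b" for a b
    proof -
      have "represented M [a] = represented M [b]"
        using that by (simp add: represented_def)
      then have "equivclp (mf_step M) [a] [b]"
        using that represented_eq_iff_equivclp[of "[a]" "[b]"] by simp
      then obtain d where "mf_reduces M [a] d" "mf_reduces M [b] d"
        using equivclp by blast
      then show "a = b"
        using mf_reduces_singleton by blast
    qed
    then show ?thesis using env_emb_hom by (auto simp: mon_def inj_on_def)
  qed
  moreover have "represented M a = \<one>\<^bsub>env_group M\<^esub> \<longleftrightarrow> mf_reduces M a []"
    if "a \<in> multifractions M" for a
  proof -
    have "represented M a = \<one>\<^bsub>env_group M\<^esub> \<longleftrightarrow> represented M a = represented M []"
      by (simp add: represented_def)
    also have "\<dots> \<longleftrightarrow> red M a = []"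
      using rep_iff[of a "[]"] red_eq[of "[]" "[]"] Nil that by simp
    also have "\<dots> \<longleftrightarrow> mf_reduces M a []"
      using red(1)[OF that] red_eq[OF that _ Nil] by auto
    finally show ?thesis .
  qed
  ultimately show ?thesis
    using unique rep_iff represented_mf_mult rep_red by simp
qed

end
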